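(* The transience class of the Abelian sandpile model on the $n \times n$ grid $\square_n$ satisfies $\mathrm{tcl}(\square_n) = O(n^{4}\log^4 n)$ as $n\to\infty$.
   Context: The graph $\square_n$ has vertex set $\{1,\dots,n\}^2 \cup \{s\}$, where $s$ is a sink vertex. Two non-sink vertices are joined by an edge if they differ by exactly $1$ in exactly one coordinate. Each boundary vertex is joined to $s$ by additional (possibly parallel) edges so that every non-sink vertex has degree exactly $4$. Abelian sandpile model on a finite multigraph $G$ with sink $s$: a configuration assigns a nonnegative integer number of grains $\sigma(v)$ to each non-sink vertex $v$. A non-sink vertex $v$ with $\sigma(v)\ge \deg(v)$ may topple, sending one grain along each incident edge; grains sent to $s$ disappear. A configuration in which no vertex can topple is stable. Repeated toppling always terminates, and the resulting stable configuration does not depend on the order of topplings. One step of the process adds one grain at a chosen non-sink vertex and then stabilizes. A stable configuration is recurrent if it can be revisited by this process; otherwise it is transient. The transience class $\mathrm{tcl}(G)$ is the maximum number of grains that can be added, one at a time at adversarially chosen non-sink vertices and stabilizing after each addition, starting from the empty (all-zero) configuration, before the configuration necessarily becomes recurrent. *)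

theory Defs
  imports Complex_Main "HOL-Library.Extended_Nat" "HOL-Library.Landau_Symbols"
begin

section \<open>The Abelian sandpile model on a finite multigraph with sink\<close>

text \<open>\<open>mult G u v\<close> is the number of parallel edges between \<open>u\<close> and \<open>v\<close>.\<close>

record 'v sink_graph =
  verts :: "'v set"
  sink :: 'v
  mult :: "'v \<Rightarrow> 'v \<Rightarrow> nat"

definition nonsink :: "'v sink_graph \<Rightarrow> 'v set" where
  "nonsink G = verts G - {sink G}"

definition deg :: "'v sink_graph \<Rightarrow> 'v \<Rightarrow> nat" where
  "deg G v = (\<Sum>u\<in>verts G. mult G v u)"

text \<open>A configuration is a function \<open>'v \<Rightarrow> nat\<close> of which only the values on \<open>nonsink G\<close> matter;
  no operation below changes the other values, which are 0 for every configuration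
  obtained from \<open>empty_config\<close>.\<close>

definition empty_config :: "'v \<Rightarrow> nat" where
  "empty_config = (\<lambda>_. 0)"

definition add_grain :: "'v \<Rightarrow> ('v \<Rightarrow> nat) \<Rightarrow> 'v \<Rightarrow> nat" where
  "add_grain v \<sigma> = \<sigma>(v := \<sigma> v + 1)"

definition topple :: "'v sink_graph \<Rightarrow> 'v \<Rightarrow> ('v \<Rightarrow> nat) \<Rightarrow> 'v \<Rightarrow> nat" where
  "topple G v \<sigma> = (\<lambda>u. if u \<in> nonsink G
      then \<sigma> u + mult G v u - (if u = v then deg G v else 0) else \<sigma> u)"

definition topples_to :: "'v sink_graph \<Rightarrow> ('v \<Rightarrow> nat) \<Rightarrow> ('v \<Rightarrow> nat) \<Rightarrow> bool" where
  "topples_to G \<sigma> \<tau> \<longleftrightarrow> (\<exists>v\<in>nonsink G. \<sigma> v \<ge> deg G v \<and> \<tau> = topple G v \<sigma>)"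

definition stable :: "'v sink_graph \<Rightarrow> ('v \<Rightarrow> nat) \<Rightarrow> bool" where
  "stable G \<sigma> \<longleftrightarrow> (\<forall>v\<in>nonsink G. \<sigma> v < deg G v)"

text \<open>Stabilization is kept as a relation, so that no definition depends on termination or on
  independence of the order of topplings.\<close>

definition stabilizes_to :: "'v sink_graph \<Rightarrow> ('v \<Rightarrow> nat) \<Rightarrow> ('v \<Rightarrow> nat) \<Rightarrow> bool" where
  "stabilizes_to G \<sigma> \<tau> \<longleftrightarrow> (topples_to G)\<^sup>*\<^sup>* \<sigma> \<tau> \<and> stable G \<tau>"

definition sandpile_step :: "'v sink_graph \<Rightarrow> ('v \<Rightarrow> nat) \<Rightarrow> ('v \<Rightarrow> nat) \<Rightarrow> bool" where
  "sandpile_step G \<sigma> \<tau> \<longleftrightarrow> (\<exists>v\<in>nonsink G. stabilizes_to G (add_grain v \<sigma>) \<tau>)"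

text \<open>Recurrence is the possibility of returning after at least one step. This agrees with
  recurrence in the Markov chain sense when \<open>nonsink G\<close> is connected, as in the grid.\<close>

definition recurrent :: "'v sink_graph \<Rightarrow> ('v \<Rightarrow> nat) \<Rightarrow> bool" where
  "recurrent G \<sigma> \<longleftrightarrow> stable G \<sigma> \<and> (sandpile_step G)\<^sup>+\<^sup>+ \<sigma> \<sigma>"

definition transient :: "'v sink_graph \<Rightarrow> ('v \<Rightarrow> nat) \<Rightarrow> bool" where
  "transient G \<sigma> \<longleftrightarrow> stable G \<sigma> \<and> \<not> recurrent G \<sigma>"

text \<open>The largest number of grains after which the configuration can still be transient. The value
  in \<^typ>\<open>enat\<close> is \<open>\<infinity>\<close> if there is no largest such number, and 0 if the empty configuration is
  already recurrent.\<close>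

definition tcl :: "'v sink_graph \<Rightarrow> enat" where
  "tcl G = Sup (enat ` {t. \<exists>\<sigma>. (sandpile_step G ^^ t) empty_config \<sigma> \<and> transient G \<sigma>})"


section \<open>The square grid\<close>

definition grid_adj :: "nat \<times> nat \<Rightarrow> nat \<times> nat \<Rightarrow> bool" where
  "grid_adj p q \<longleftrightarrow>
     (fst p = fst q \<and> (snd q = snd p + 1 \<or> snd p = snd q + 1)) \<or>
     (snd p = snd q \<and> (fst q = fst p + 1 \<or> fst p = fst q + 1))"

definition grid_cells :: "nat \<Rightarrow> (nat \<times> nat) set" where
  "grid_cells n = {1..n} \<times> {1..n}"

text \<open>The number of edges to the sink that makes the degree 4; it is 0 off the boundary
  (truncated subtraction does no harm, see \<open>deg_grid\<close> below).\<close>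

definition grid_sink_mult :: "nat \<Rightarrow> nat \<times> nat \<Rightarrow> nat" where
  "grid_sink_mult n p = 4 - card {q \<in> grid_cells n. grid_adj p q}"

text \<open>\<open>None\<close> is the sink.\<close>

definition grid :: "nat \<Rightarrow> (nat \<times> nat) option sink_graph" where
  "grid n = \<lparr>
     verts = insert None (Some ` grid_cells n),
     sink = None,
     mult = (\<lambda>u v. case (u, v) of
         (Some p, Some q) \<Rightarrow> if grid_adj p q then 1 else 0
       | (Some p, None) \<Rightarrow> grid_sink_mult n p
       | (None, Some q) \<Rightarrow> grid_sink_mult n q
       | (None, None) \<Rightarrow> 0)\<rparr>"

lemma nonsink_grid: "nonsink (grid n) = Some ` grid_cells n"
  by (auto simp: nonsink_def grid_def)

lemma mult_grid_sym: "mult (grid n) u v = mult (grid n) v u"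
  by (auto simp: grid_def grid_adj_def split: option.splits)

lemma card_grid_adj_le: "card {q \<in> grid_cells n. grid_adj p q} \<le> 4"
proof -
  let ?N = "[(fst p, snd p + 1), (fst p, snd p - 1), (fst p + 1, snd p), (fst p - 1, snd p)]"
  have "{q \<in> grid_cells n. grid_adj p q} \<subseteq> set ?N"
    by (auto simp: grid_adj_def)
  then have "card {q \<in> grid_cells n. grid_adj p q} \<le> card (set ?N)"
    by (intro card_mono) auto
  also have "\<dots> \<le> length ?N"
    by (rule card_length)
  finally show ?thesis by simp
qed

lemma deg_grid:
  assumes "v \<in> nonsink (grid n)"
  shows "deg (grid n) v = 4"
proof -
  obtain p where p: "v = Some p"
    using assms by (auto simp: nonsink_grid)
  have fin: "finite (grid_cells n)"
    by (simp add: grid_cells_def)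
  have "deg (grid n) v = grid_sink_mult n p + (\<Sum>q\<in>grid_cells n. if grid_adj p q then 1 else 0)"
    using fin by (simp add: deg_def grid_def p sum.reindex)
  also have "(\<Sum>q\<in>grid_cells n. if grid_adj p q then 1 else 0) = card {q \<in> grid_cells n. grid_adj p q}"
    using fin by (simp add: sum.If_cases Int_def)
  finally show ?thesis
    using card_grid_adj_le[of n p] by (simp add: grid_sink_mult_def)
qed

end

theory Submission
  imports Defs
begin

text \<open>
  Let \<open>\<Delta>\<close> be the Laplacian with zero boundary values outside the square. If the configuration \<open>\<sigma>\<close> is
  transient after \<open>t\<close> additions, the burning test gives a cell \<open>x\<close> that has never toppled. Let \<open>b\<close>
  be the added grains and \<open>z\<close> the numbers of topplings, so that \<open>\<sigma> = b - \<Delta> z\<close> and \<open>z x = 0\<close>. For any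
  \<open>U \<ge> 0\<close> with \<open>\<Delta> U \<ge> 1\<close>, the function \<open>w = z + 3 U\<close> satisfies \<open>\<Delta> w \<ge> b\<close> and \<open>w x = 3 U x\<close>. Let \<open>g > 0\<close>
  be subharmonic off a single cell \<open>c\<close>. Pairing \<open>g\<close> with \<open>\<Delta> w\<close> gives \<open>t min g \<le> w c (\<Delta> g) c\<close>, and the
  minimum principle gives \<open>w x \<ge> w c g x / g c\<close>. Together, \<open>t \<le> 3 (\<Delta> g) c g c U x / (g x min g)\<close>.

  Write \<open>N = n + 1\<close> and \<open>d k = k (N - k) / N\<close>. A product of two entropy functions serves as \<open>U\<close>, with
  \<open>U (i, j)\<close> of order at most \<open>d i d j ln\<^sup>2 N\<close>. For \<open>g\<close> take, with \<open>c\<close> in the centre, the maximum of a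
  logarithmic pole at \<open>c\<close> and a product of two polynomials of order \<open>d i d j / N\<^sup>2\<close>; then \<open>g c\<close> is of
  order \<open>ln N\<close> and \<open>min g\<close> of order at least \<open>N\<^sup>-\<^sup>2\<close>. This gives \<open>t = O(n\<^sup>4 ln\<^sup>3 n)\<close>.
\<close>


section \<open>Toppling on the grid\<close>

definition nbrs :: "nat \<Rightarrow> nat \<times> nat \<Rightarrow> (nat \<times> nat) set" where
  "nbrs n p = {q \<in> grid_cells n. grid_adj p q}"

lemma finite_grid_cells [simp]: "finite (grid_cells n)"
  by (simp add: grid_cells_def)

lemma finite_nbrs [simp]: "finite (nbrs n p)"
  by (simp add: nbrs_def)

lemma nbrs_subset: "nbrs n p \<subseteq> grid_cells n"
  by (auto simp: nbrs_def)

lemma grid_adj_sym: "grid_adj p q \<longleftrightarrow> grid_adj q p"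
  by (auto simp: grid_adj_def)

lemma self_notin_nbrs [simp]: "p \<notin> nbrs n p"
  by (simp add: nbrs_def grid_adj_def)

lemma card_nbrs_le: "card (nbrs n p) \<le> 4"
  using card_grid_adj_le by (simp add: nbrs_def)

lemma sink_mult_plus_card_nbrs: "grid_sink_mult n p + card (nbrs n p) = 4"
  using card_grid_adj_le[of n p] by (simp add: grid_sink_mult_def nbrs_def)

lemma topple_grid_Some:
  assumes "p \<in> grid_cells n" "q \<in> grid_cells n"
  shows "topple (grid n) (Some p) \<eta> (Some q) =
    \<eta> (Some q) + (if q \<in> nbrs n p then 1 else 0) - (if q = p then 4 else 0)"
proof -
  have "Some p \<in> nonsink (grid n)" "Some q \<in> nonsink (grid n)"
    using assms by (auto simp: nonsink_grid)
  moreover have "mult (grid n) (Some p) (Some q) = (if q \<in> nbrs n p then 1 else 0)"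
    using assms by (simp add: grid_def nbrs_def)
  ultimately show ?thesis
    using deg_grid[of "Some p" n] by (auto simp: topple_def)
qed

lemma topple_grid_other:
  "v \<notin> Some ` grid_cells n \<Longrightarrow> topple (grid n) u \<eta> v = \<eta> v"
  by (simp add: topple_def nonsink_grid)

lemma topples_to_grid_iff:
  "topples_to (grid n) \<eta> \<eta>' \<longleftrightarrow>
    (\<exists>p\<in>grid_cells n. 4 \<le> \<eta> (Some p) \<and> \<eta>' = topple (grid n) (Some p) \<eta>)"
  using deg_grid[of _ n] by (auto simp: topples_to_def nonsink_grid)

lemma stable_grid_iff: "stable (grid n) \<eta> \<longleftrightarrow> (\<forall>p\<in>grid_cells n. \<eta> (Some p) < 4)"
  using deg_grid[of _ n] by (auto simp: stable_def nonsink_grid)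

lemma sum_nbrs_fun_upd_Suc:
  fixes z :: "nat \<times> nat \<Rightarrow> nat"
  shows "(\<Sum>q\<in>nbrs n p. (z(r := Suc (z r))) q) = (\<Sum>q\<in>nbrs n p. z q) + (if r \<in> nbrs n p then 1 else 0)"
proof -
  have "(\<Sum>q\<in>nbrs n p. (z(r := Suc (z r))) q) = (\<Sum>q\<in>nbrs n p. z q + (if r = q then 1 else 0))"
    by (intro sum.cong) auto
  also have "\<dots> = (\<Sum>q\<in>nbrs n p. z q) + (if r \<in> nbrs n p then 1 else 0)"
    by (simp add: sum.distrib)
  finally show ?thesis .
qed

text \<open>\<open>s p\<close> counts the grains put at \<open>p\<close> so far and \<open>z p\<close> the topplings at \<open>p\<close>. The equation is
  \<open>\<eta> = s - \<Delta> z\<close> without subtraction.\<close>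

definition balance :: "nat \<Rightarrow> (nat \<times> nat \<Rightarrow> nat) \<Rightarrow> (nat \<times> nat \<Rightarrow> nat) \<Rightarrow>
    ((nat \<times> nat) option \<Rightarrow> nat) \<Rightarrow> bool" where
  "balance n s z \<eta> \<longleftrightarrow> (\<forall>p\<in>grid_cells n. \<eta> (Some p) + 4 * z p = s p + (\<Sum>q\<in>nbrs n p. z q))"

lemma balance_topple:
  assumes "balance n s z \<eta>" and p: "p \<in> grid_cells n" "4 \<le> \<eta> (Some p)"
  shows "balance n s (z(p := Suc (z p))) (topple (grid n) (Some p) \<eta>)"
  unfolding balance_def
proof
  fix q assume q: "q \<in> grid_cells n"
  have "q \<in> nbrs n p \<longleftrightarrow> p \<in> nbrs n q"
    using p q grid_adj_sym by (auto simp: nbrs_def)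
  moreover have "\<eta> (Some q) + 4 * z q = s q + (\<Sum>r\<in>nbrs n q. z r)"
    using assms(1) q by (simp add: balance_def)
  ultimately show "topple (grid n) (Some p) \<eta> (Some q) + 4 * (z(p := Suc (z p))) q =
      s q + (\<Sum>r\<in>nbrs n q. (z(p := Suc (z p))) r)"
    unfolding sum_nbrs_fun_upd_Suc using p q by (auto simp: topple_grid_Some)
qed

lemma balance_add_grain:
  "balance n s z \<eta> \<Longrightarrow> balance n (s(p := Suc (s p))) z (add_grain (Some p) \<eta>)"
  by (auto simp: balance_def add_grain_def)


section \<open>Recurrence\<close>

text \<open>A nonempty \<open>F\<close> that violates this is a forbidden subconfiguration in Dhar's
  sense. The parameter \<open>S\<close> lets the condition grow with the set of cells that have
  toppled, starting from the empty set.\<close>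

definition no_forbidden_subset :: "nat \<Rightarrow> (nat \<times> nat) set \<Rightarrow> ((nat \<times> nat) option \<Rightarrow> nat) \<Rightarrow> bool" where
  "no_forbidden_subset n S \<eta> \<longleftrightarrow>
    (\<forall>F\<subseteq>S. F \<noteq> {} \<longrightarrow> (\<exists>p\<in>F. card (nbrs n p \<inter> F) \<le> \<eta> (Some p)))"

lemma no_forbidden_subset_add_grain:
  assumes "no_forbidden_subset n S \<eta>"
  shows "no_forbidden_subset n S (add_grain v \<eta>)"
  unfolding no_forbidden_subset_def
proof (intro allI impI)
  fix F assume "F \<subseteq> S" "F \<noteq> {}"
  with assms obtain p where "p \<in> F" "card (nbrs n p \<inter> F) \<le> \<eta> (Some p)"
    unfolding no_forbidden_subset_def by blast
  moreover have "\<eta> (Some p) \<le> add_grain v \<eta> (Some p)"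
    by (simp add: add_grain_def)
  ultimately show "\<exists>p\<in>F. card (nbrs n p \<inter> F) \<le> add_grain v \<eta> (Some p)"
    by (meson le_trans)
qed

text \<open>A witness \<open>q\<close> for \<open>F - {p}\<close> is also one for \<open>F\<close>:
  when \<open>p\<close> is a neighbour of \<open>q\<close>, the extra neighbour in \<open>F\<close>
  is paid for by the grain that \<open>p\<close> sends to \<open>q\<close>. For
  \<open>F = {p}\<close> the count is 0, as \<open>p\<close> is not its own neighbour.\<close>

lemma no_forbidden_subset_topple:
  assumes S: "no_forbidden_subset n S \<eta>" "S \<subseteq> grid_cells n" and p: "p \<in> grid_cells n"
  shows "no_forbidden_subset n (insert p S) (topple (grid n) (Some p) \<eta>)"
  unfolding no_forbidden_subset_def
proof (intro allI impI)
  fix F assume F: "F \<subseteq> insert p S" "F \<noteq> {}"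
  show "\<exists>q\<in>F. card (nbrs n q \<inter> F) \<le> topple (grid n) (Some p) \<eta> (Some q)"
  proof (cases "F = {p}")
    case True
    then show ?thesis by simp
  next
    case False
    with F have "F - {p} \<noteq> {}" "F - {p} \<subseteq> S" by auto
    with S obtain q where q: "q \<in> F - {p}" "card (nbrs n q \<inter> (F - {p})) \<le> \<eta> (Some q)"
      unfolding no_forbidden_subset_def by blast
    have qc: "q \<in> grid_cells n"
      using q F S by auto
    have *: "topple (grid n) (Some p) \<eta> (Some q) = \<eta> (Some q) + (if p \<in> nbrs n q then 1 else 0)"
      using q p qc grid_adj_sym by (auto simp: topple_grid_Some nbrs_def)
    have "nbrs n q \<inter> F \<subseteq> (nbrs n q \<inter> (F - {p})) \<union> (if p \<in> nbrs n q then {p} else {})"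
      by auto
    then have "card (nbrs n q \<inter> F)
        \<le> card ((nbrs n q \<inter> (F - {p})) \<union> (if p \<in> nbrs n q then {p} else {}))"
      by (intro card_mono) auto
    also have "\<dots> \<le> card (nbrs n q \<inter> (F - {p})) + card (if p \<in> nbrs n q then {p} else {})"
      by (rule card_Un_le)
    also have "\<dots> \<le> topple (grid n) (Some p) \<eta> (Some q)"
      using q(2) * by auto
    finally show ?thesis using q(1) by auto
  qed
qed

text \<open>The invariant of the process, with \<open>z\<close> the odometer of the topplings
  carried out: the cells that have toppled contain no forbidden subset.\<close>

definition history :: "nat \<Rightarrow> (nat \<times> nat \<Rightarrow> nat) \<Rightarrow> (nat \<times> nat \<Rightarrow> nat) \<Rightarrow>
    ((nat \<times> nat) option \<Rightarrow> nat) \<Rightarrow> bool" where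
  "history n b z \<eta> \<longleftrightarrow> balance n b z \<eta> \<and> no_forbidden_subset n {p \<in> grid_cells n. 0 < z p} \<eta>"

lemma history_topplings:
  assumes "(topples_to (grid n))\<^sup>*\<^sup>* \<eta> \<eta>'" "history n b z \<eta>"
  shows "\<exists>z'. history n b z' \<eta>'"
  using assms
proof (induction rule: rtranclp_induct)
  case base
  then show ?case by blast
next
  case (step \<eta>\<^sub>1 \<eta>\<^sub>2)
  then obtain z where z: "history n b z \<eta>\<^sub>1" by blast
  from step.hyps obtain p where p: "p \<in> grid_cells n" "4 \<le> \<eta>\<^sub>1 (Some p)"
    "\<eta>\<^sub>2 = topple (grid n) (Some p) \<eta>\<^sub>1"
    by (auto simp: topples_to_grid_iff)
  have "{q \<in> grid_cells n. 0 < (z(p := Suc (z p))) q} = insert p {q \<in> grid_cells n. 0 < z q}"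
    using p by auto
  moreover have "no_forbidden_subset n (insert p {q \<in> grid_cells n. 0 < z q}) \<eta>\<^sub>2"
    unfolding p(3) using z p(1) by (intro no_forbidden_subset_topple) (auto simp: history_def)
  moreover have "balance n b (z(p := Suc (z p))) \<eta>\<^sub>2"
    unfolding p(3) using z p by (intro balance_topple) (auto simp: history_def)
  ultimately show ?case
    unfolding history_def by metis
qed

lemma history_steps:
  assumes "(sandpile_step (grid n) ^^ t) empty_config \<sigma>"
  shows "\<exists>b z. history n b z \<sigma> \<and> (\<Sum>p\<in>grid_cells n. b p) = t"
  using assms
proof (induction t arbitrary: \<sigma>)
  case 0
  then have "\<sigma> = empty_config" by simp
  then have "history n (\<lambda>_. 0) (\<lambda>_. 0) \<sigma>"
    by (auto simp: history_def balance_def no_forbidden_subset_def empty_config_def)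
  then show ?case by force
next
  case (Suc t)
  then obtain \<eta> where \<eta>: "(sandpile_step (grid n) ^^ t) empty_config \<eta>" "sandpile_step (grid n) \<eta> \<sigma>"
    by auto
  from Suc.IH[OF \<eta>(1)] obtain b z where
    bz: "history n b z \<eta>" "(\<Sum>p\<in>grid_cells n. b p) = t" by blast
  from \<eta>(2) obtain p where p: "p \<in> grid_cells n"
    "(topples_to (grid n))\<^sup>*\<^sup>* (add_grain (Some p) \<eta>) \<sigma>"
    by (auto simp: sandpile_step_def stabilizes_to_def nonsink_grid)
  have "history n (b(p := Suc (b p))) z (add_grain (Some p) \<eta>)"
    using bz(1) balance_add_grain no_forbidden_subset_add_grain by (auto simp: history_def)
  from history_topplings[OF p(2) this] obtain z' where "history n (b(p := Suc (b p))) z' \<sigma>" by blast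
  moreover have "(\<Sum>q\<in>grid_cells n. (b(p := Suc (b p))) q) = Suc t"
    using p(1) bz(2) by (simp add: sum.remove)
  ultimately show ?case by blast
qed

text \<open>Dhar's burning test: with one grain added per edge to the sink, no vertex topples twice.\<close>

locale burning =
  fixes n :: nat and \<sigma> :: "(nat \<times> nat) option \<Rightarrow> nat"
  assumes stable: "stable (grid n) \<sigma>"
begin

text \<open>Counting starts at \<open>\<sigma>\<close>, so \<open>balance\<close> takes
  \<open>\<sigma>\<close> together with the added grains \<open>b\<close> as its source term. The
  last clause serves to recover \<open>\<sigma>\<close> as a function, values off the cells
  included.\<close>

definition burns_to :: "(nat \<times> nat \<Rightarrow> nat) \<Rightarrow> (nat \<times> nat \<Rightarrow> nat) \<Rightarrow>
    ((nat \<times> nat) option \<Rightarrow> nat) \<Rightarrow> bool" where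
  "burns_to b z \<eta> \<longleftrightarrow> balance n (\<lambda>p. \<sigma> (Some p) + b p) z \<eta> \<and>
    (\<forall>p\<in>grid_cells n. b p \<le> grid_sink_mult n p) \<and> (\<forall>p. z p \<le> 1) \<and>
    (\<forall>v. v \<notin> Some ` grid_cells n \<longrightarrow> \<eta> v = \<sigma> v)"

lemma burns_to_le_1: "burns_to b z \<eta> \<Longrightarrow> z p \<le> 1"
  by (cases p) (simp add: burns_to_def)

text \<open>An unstable cell has not toppled before, so each toppling shrinks the set of untoppled
  cells. This gives termination and keeps \<open>z\<close> at most 1.\<close>

lemma burns_to_stable:
  assumes "burns_to b z \<eta>"
  shows "\<exists>z' \<eta>'. stabilizes_to (grid n) \<eta> \<eta>' \<and> burns_to b z' \<eta>'"
  using assms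
proof (induction "card {p \<in> grid_cells n. z p = 0}" arbitrary: z \<eta> rule: less_induct)
  case less
  show ?case
  proof (cases "stable (grid n) \<eta>")
    case True
    then show ?thesis using less.prems by (auto simp: stabilizes_to_def)
  next
    case False
    then obtain p where p: "p \<in> grid_cells n" "4 \<le> \<eta> (Some p)"
      by (auto simp: stable_grid_iff not_less)
    let ?z = "z(p := Suc (z p))" and ?\<eta> = "topple (grid n) (Some p) \<eta>"
    have "z q \<le> 1" for q
      using less.prems by (rule burns_to_le_1)
    then have "(\<Sum>q\<in>nbrs n p. z q) \<le> (\<Sum>q\<in>nbrs n p. 1)"
      by (rule sum_mono)
    then have "(\<Sum>q\<in>nbrs n p. z q) \<le> card (nbrs n p)"
      by simp
    moreover have "\<eta> (Some p) + 4 * z p = \<sigma> (Some p) + b p + (\<Sum>q\<in>nbrs n p. z q)"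
      using less.prems p by (simp add: burns_to_def balance_def)
    moreover have "b p \<le> grid_sink_mult n p"
      using less.prems p by (simp add: burns_to_def)
    moreover have "\<sigma> (Some p) < 4"
      using stable p by (simp add: stable_grid_iff)
    \<comment> \<open>Grains present or received number at most 3 from \<open>\<sigma>\<close> plus
      4 from sink edges and neighbours, and 7 - 4 is below the threshold 4.\<close>
    ultimately have zp: "z p = 0"
      using sink_mult_plus_card_nbrs[of n p] p(2) by linarith
    have "{q \<in> grid_cells n. ?z q = 0} \<subset> {q \<in> grid_cells n. z q = 0}"
      using zp p(1) by (auto split: if_splits)
    then have "card {q \<in> grid_cells n. ?z q = 0} < card {q \<in> grid_cells n. z q = 0}"
      by (intro psubset_card_mono) auto
    moreover have "burns_to b ?z ?\<eta>"
      using less.prems p zp balance_topple[of n "\<lambda>p. \<sigma> (Some p) + b p" z \<eta> p]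
      by (auto simp: burns_to_def topple_grid_other)
    ultimately obtain z' \<eta>' where "stabilizes_to (grid n) ?\<eta> \<eta>'" "burns_to b z' \<eta>'"
      using less.hyps by blast
    moreover have "topples_to (grid n) \<eta> ?\<eta>"
      using p by (auto simp: topples_to_grid_iff)
    ultimately show ?thesis
      unfolding stabilizes_to_def by (meson converse_rtranclp_into_rtranclp)
  qed
qed

text \<open>The boundary grains enter one by one, since a sandpile step adds a single grain; as long
  as \<open>k\<close> is below the number of sink edges, some cell still has room for one.\<close>

lemma burning_steps:
  assumes "k \<le> (\<Sum>p\<in>grid_cells n. grid_sink_mult n p)"
  shows "\<exists>b z \<eta>. (sandpile_step (grid n) ^^ k) \<sigma> \<eta> \<and> burns_to b z \<eta> \<and> stable (grid n) \<eta> \<and>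
    (\<Sum>p\<in>grid_cells n. b p) = k"
  using assms
proof (induction k)
  case 0
  have "burns_to (\<lambda>_. 0) (\<lambda>_. 0) \<sigma>"
    by (auto simp: burns_to_def balance_def)
  then have *: "(sandpile_step (grid n) ^^ 0) \<sigma> \<sigma> \<and> burns_to (\<lambda>_. 0) (\<lambda>_. 0) \<sigma> \<and>
      stable (grid n) \<sigma> \<and> (\<Sum>p\<in>grid_cells n. 0 :: nat) = 0"
    using stable by simp
  show ?case
    by (rule exI[where x = "\<lambda>_. 0"], rule exI[where x = "\<lambda>_. 0"], rule exI[where x = \<sigma>], rule *)
next
  case (Suc k)
  then obtain b z \<eta> where IH: "(sandpile_step (grid n) ^^ k) \<sigma> \<eta>" "burns_to b z \<eta>"
    "(\<Sum>p\<in>grid_cells n. b p) = k" by force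
  have "\<exists>p\<in>grid_cells n. b p < grid_sink_mult n p"
  proof (rule ccontr)
    assume "\<not> ?thesis"
    then have "(\<Sum>p\<in>grid_cells n. grid_sink_mult n p) \<le> (\<Sum>p\<in>grid_cells n. b p)"
      by (intro sum_mono) (auto simp: not_less)
    with IH Suc.prems show False by simp
  qed
  then obtain p where p: "p \<in> grid_cells n" "b p < grid_sink_mult n p" by blast
  let ?b = "b(p := Suc (b p))"
  have "(\<lambda>q. \<sigma> (Some q) + b q)(p := Suc (\<sigma> (Some p) + b p)) = (\<lambda>q. \<sigma> (Some q) + ?b q)"
    by auto
  then have "balance n (\<lambda>q. \<sigma> (Some q) + ?b q) z (add_grain (Some p) \<eta>)"
    using IH(2) balance_add_grain[of n "\<lambda>q. \<sigma> (Some q) + b q" z \<eta> p] by (simp add: burns_to_def)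
  then have "burns_to ?b z (add_grain (Some p) \<eta>)"
    using IH(2) p by (auto simp: burns_to_def add_grain_def)
  then obtain z' \<eta>' where *: "stabilizes_to (grid n) (add_grain (Some p) \<eta>) \<eta>'" "burns_to ?b z' \<eta>'"
    using burns_to_stable by blast
  have "sandpile_step (grid n) \<eta> \<eta>'"
    using p(1) *(1) by (auto simp: sandpile_step_def nonsink_grid)
  then have "(sandpile_step (grid n) ^^ Suc k) \<sigma> \<eta>'"
    using IH(1) by auto
  moreover have "(\<Sum>q\<in>grid_cells n. ?b q) = Suc k"
    using p(1) IH(3) by (simp add: sum.remove)
  moreover have "stable (grid n) \<eta>'"
    using *(1) by (simp add: stabilizes_to_def)
  ultimately show ?case
    using *(2) by blast
qed

text \<open>The unburnt cells \<open>F\<close> would be forbidden: a cell of \<open>F\<close> with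
  at least as many grains as neighbours in \<open>F\<close> would hold 4 grains after its sink edges
  and burnt neighbours have contributed. So every cell topples exactly once, losing 4 grains and
  receiving 4.\<close>

lemma burns_to_self:
  assumes "no_forbidden_subset n (grid_cells n) \<sigma>"
    and burns: "burns_to b z \<eta>" and \<eta>: "stable (grid n) \<eta>"
    and b: "\<And>p. p \<in> grid_cells n \<Longrightarrow> b p = grid_sink_mult n p"
  shows "\<eta> = \<sigma>"
proof -
  define F where "F = {p \<in> grid_cells n. z p = 0}"
  have bal: "\<eta> (Some p) + 4 * z p = \<sigma> (Some p) + grid_sink_mult n p + card (nbrs n p - F)"
    if p: "p \<in> grid_cells n" for p
  proof -
    have "(\<Sum>q\<in>nbrs n p. z q) = (\<Sum>q\<in>nbrs n p. if q \<in> F then 0 else 1)"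
    proof (intro sum.cong refl)
      fix q assume "q \<in> nbrs n p"
      then have "q \<in> grid_cells n" by (simp add: nbrs_def)
      moreover have "z q \<le> 1" using burns by (rule burns_to_le_1)
      ultimately show "z q = (if q \<in> F then 0 else 1)" by (auto simp: F_def)
    qed
    also have "\<dots> = card (nbrs n p - F)"
      by (simp add: sum.If_cases Diff_eq)
    finally show ?thesis
      using burns p b[OF p] by (simp add: burns_to_def balance_def)
  qed
  have split: "card (nbrs n p) = card (nbrs n p \<inter> F) + card (nbrs n p - F)" for p
    using card_Un_disjoint[of "nbrs n p \<inter> F" "nbrs n p - F"]
    by (simp add: Int_Diff_Un Int_Diff_disjoint)
  have "F = {}"
  proof (rule ccontr)
    assume "F \<noteq> {}"
    moreover have "F \<subseteq> grid_cells n"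
      by (auto simp: F_def)
    ultimately obtain p where p: "p \<in> F" "card (nbrs n p \<inter> F) \<le> \<sigma> (Some p)"
      using assms(1)[unfolded no_forbidden_subset_def, rule_format, of F] by blast
    then have pc: "p \<in> grid_cells n" and "z p = 0" by (auto simp: F_def)
    then have "4 \<le> \<eta> (Some p)"
      using p(2) split[of p] bal[OF pc] sink_mult_plus_card_nbrs[of n p] by linarith
    with \<eta> pc show False by (auto simp: stable_grid_iff)
  qed
  have "\<eta> v = \<sigma> v" for v
  proof (cases "v \<in> Some ` grid_cells n")
    case True
    then obtain p where p: "p \<in> grid_cells n" "v = Some p" by auto
    moreover have "z p = 1"
    proof -
      have "p \<notin> F" using \<open>F = {}\<close> by simp
      then have "z p \<noteq> 0" using p by (simp add: F_def)
      moreover have "z p \<le> 1" using burns by (rule burns_to_le_1)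
      ultimately show ?thesis by simp
    qed
    ultimately show ?thesis
      using bal[OF p(1)] sink_mult_plus_card_nbrs[of n p] \<open>F = {}\<close> by simp
  next
    case False
    then show ?thesis using burns by (simp add: burns_to_def)
  qed
  then show ?thesis by auto
qed

end

section \<open>From the burning test to an untoppled cell\<close>

lemma grid_sink_mult_corner: "0 < grid_sink_mult n (1, 1)"
proof -
  have "nbrs n (1, 1) \<subseteq> {(1, 2), (2, 1)}"
    by (auto simp: nbrs_def grid_adj_def grid_cells_def)
  then have "card (nbrs n (1, 1)) \<le> card {(1, 2), (2, 1) :: nat \<times> nat}"
    by (intro card_mono) auto
  then show ?thesis
    using sink_mult_plus_card_nbrs[of n "(1, 1)"] by (simp add: card_insert_if)
qed

lemma recurrent_if_no_forbidden_subset: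
  assumes "1 \<le> n" "stable (grid n) \<sigma>" "no_forbidden_subset n (grid_cells n) \<sigma>"
  shows "recurrent (grid n) \<sigma>"
proof -
  interpret burning n \<sigma> by unfold_locales fact
  let ?k = "\<Sum>p\<in>grid_cells n. grid_sink_mult n p"
  obtain b z \<eta> where *: "(sandpile_step (grid n) ^^ ?k) \<sigma> \<eta>" "burns_to b z \<eta>" "stable (grid n) \<eta>"
    "(\<Sum>p\<in>grid_cells n. b p) = ?k"
    using burning_steps[of ?k] by auto
  \<comment> \<open>Pointwise \<open>b\<close> is at most the number of sink edges, and the totals
    agree.\<close>
  have "b p = grid_sink_mult n p" if p: "p \<in> grid_cells n" for p
  proof (rule ccontr)
    assume "b p \<noteq> grid_sink_mult n p"
    then have "(\<Sum>p\<in>grid_cells n. b p) < ?k"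
      using *(2) p by (intro sum_strict_mono_ex1) (auto simp: burns_to_def order_less_le)
    with *(4) show False by simp
  qed
  with assms(3) * have "\<eta> = \<sigma>"
    by (intro burns_to_self)
  moreover have "(1, 1) \<in> grid_cells n"
    using assms(1) by (simp add: grid_cells_def)
  \<comment> \<open>Recurrence asks for a return after at least one step; the corner supplies a sink
    edge.\<close>
  then have "0 < ?k"
    using grid_sink_mult_corner[of n] by (meson finite_grid_cells sum_pos2 zero_le)
  ultimately have "(sandpile_step (grid n))\<^sup>+\<^sup>+ \<sigma> \<sigma>"
    using *(1) by (auto simp: tranclp_power)
  then show ?thesis
    using assms(2) by (simp add: recurrent_def)
qed

text \<open>Had every cell toppled, the invariant \<open>history\<close> would exclude forbidden
  subsets of the whole grid, and \<open>\<sigma>\<close> would be recurrent.\<close>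

lemma transient_untoppled:
  assumes "1 \<le> n" "(sandpile_step (grid n) ^^ t) empty_config \<sigma>" "transient (grid n) \<sigma>"
  shows "\<exists>b z. balance n b z \<sigma> \<and> (\<Sum>p\<in>grid_cells n. b p) = t \<and> (\<exists>p\<in>grid_cells n. z p = 0)"
proof -
  obtain b z where bz: "history n b z \<sigma>" "(\<Sum>p\<in>grid_cells n. b p) = t"
    using history_steps[OF assms(2)] by blast
  have "\<not> no_forbidden_subset n (grid_cells n) \<sigma>"
    using recurrent_if_no_forbidden_subset assms by (auto simp: transient_def)
  then have "{p \<in> grid_cells n. 0 < z p} \<noteq> grid_cells n"
    using bz(1) by (auto simp: history_def)
  then show ?thesis
    using bz by (auto simp: history_def)
qed


section \<open>Potential theory on the grid\<close>

text \<open>The positive Laplacian, so superharmonic means \<open>0 \<le> lap n h p\<close>. The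
  factor 4 is kept at the boundary, which puts the value 0 at the sink.\<close>

definition lap :: "nat \<Rightarrow> (nat \<times> nat \<Rightarrow> real) \<Rightarrow> nat \<times> nat \<Rightarrow> real" where
  "lap n h p = 4 * h p - (\<Sum>q\<in>nbrs n p. h q)"

lemma lap_add: "lap n (\<lambda>p. f p + g p) p = lap n f p + lap n g p"
  by (simp add: lap_def sum.distrib)

lemma lap_diff: "lap n (\<lambda>p. f p - g p) p = lap n f p - lap n g p"
  by (simp add: lap_def sum_subtractf)

lemma lap_cmult: "lap n (\<lambda>p. k * f p) p = k * lap n f p"
  by (simp add: lap_def sum_distrib_left algebra_simps)

lemma sum_nbrs_eq:
  fixes h :: "nat \<times> nat \<Rightarrow> real"
  shows "(\<Sum>q\<in>nbrs n p. h q) = (\<Sum>q\<in>grid_cells n. if grid_adj p q then h q else 0)"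
  by (simp add: nbrs_def sum.inter_filter)

lemma lap_symmetric: "(\<Sum>p\<in>grid_cells n. f p * lap n g p) = (\<Sum>p\<in>grid_cells n. g p * lap n f p)"
proof -
  have expand: "(\<Sum>p\<in>grid_cells n. f p * lap n g p) = (\<Sum>p\<in>grid_cells n. 4 * f p * g p) -
      (\<Sum>p\<in>grid_cells n. \<Sum>q\<in>grid_cells n. if grid_adj p q then f p * g q else 0)" for f g
    unfolding lap_def sum_nbrs_eq
    by (simp add: algebra_simps sum_subtractf sum_distrib_left if_distrib cong: if_cong)
  have "(\<Sum>p\<in>grid_cells n. \<Sum>q\<in>grid_cells n. if grid_adj p q then f p * g q else 0) =
      (\<Sum>p\<in>grid_cells n. \<Sum>q\<in>grid_cells n. if grid_adj p q then g p * f q else 0)"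
    by (subst sum.swap, intro sum.cong refl) (simp add: grid_adj_sym mult.commute)
  then show ?thesis
    unfolding expand by (simp add: ac_simps)
qed

section \<open>Minimum principle\<close>

lemma card_nbrs_boundary:
  assumes "(i, j) \<in> grid_cells n" "(i - 1, j) \<notin> grid_cells n"
  shows "card (nbrs n (i, j)) \<le> 3"
proof -
  have "nbrs n (i, j) \<subseteq> {(Suc i, j), (i, Suc j), (i, j - 1)}"
    using assms by (auto simp: nbrs_def grid_adj_def)
  then have "card (nbrs n (i, j)) \<le> card {(Suc i, j), (i, Suc j), (i, j - 1)}"
    by (intro card_mono) auto
  also have "\<dots> \<le> 3"
    by (simp add: card_insert_if)
  finally show ?thesis .
qed

text \<open>Among the cells where a negative minimum \<open>m\<close> is attained, take one with
  least first coordinate. Its left neighbour either has a value above \<open>m\<close> or lies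
  outside the grid, and in both cases the neighbour sum exceeds \<open>4 * m\<close>, against
  superharmonicity.\<close>

lemma minimum_principle:
  assumes super: "\<And>p. p \<in> grid_cells n - {c} \<Longrightarrow> 0 \<le> lap n e p" and c: "0 \<le> e c"
    and x: "x \<in> grid_cells n"
  shows "0 \<le> e x"
proof (rule ccontr)
  assume neg: "\<not> 0 \<le> e x"
  define m where "m = Min (e ` grid_cells n)"
  have m_le: "m \<le> e p" if "p \<in> grid_cells n" for p
    using that by (simp add: m_def)
  have "m < 0"
    using m_le[OF x] neg by linarith
  have "m \<in> e ` grid_cells n"
    unfolding m_def using x by (intro Min_in) auto
  then have ex: "\<exists>i j. (i, j) \<in> grid_cells n \<and> e (i, j) = m" by force
  define i where "i = (LEAST i. \<exists>j. (i, j) \<in> grid_cells n \<and> e (i, j) = m)"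
  obtain j where ij: "(i, j) \<in> grid_cells n" "e (i, j) = m"
    using LeastI_ex[OF ex] unfolding i_def by blast
  have i1: "1 \<le> i"
    using ij(1) by (simp add: grid_cells_def)
  have "(i, j) \<noteq> c"
    using ij(2) c \<open>m < 0\<close> by auto
  then have sum_le: "(\<Sum>q\<in>nbrs n (i, j). e q) \<le> 4 * m"
    using super[of "(i, j)"] ij by (simp add: lap_def)
  have e_ge: "m \<le> e q" if "q \<in> nbrs n (i, j)" for q
    using that m_le nbrs_subset by blast
  show False
  proof (cases "(i - 1, j) \<in> grid_cells n")
    case True
    then have mem: "(i - 1, j) \<in> nbrs n (i, j)"
      using i1 by (simp add: nbrs_def grid_adj_def)
    have "e (i - 1, j) \<noteq> m"
    proof
      assume "e (i - 1, j) = m"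
      with True have "i \<le> i - 1"
        unfolding i_def by (intro Least_le) (auto simp: i_def)
      with i1 show False by simp
    qed
    then have less: "m < e (i - 1, j)"
      using e_ge[OF mem] by simp
    have "real (card (nbrs n (i, j))) * m < (\<Sum>q\<in>nbrs n (i, j). e q)"
      using sum_strict_mono_ex1[of "nbrs n (i, j)" "\<lambda>_. m" e] e_ge less mem by auto
    moreover have "4 * m \<le> real (card (nbrs n (i, j))) * m"
      using card_nbrs_le[of n "(i, j)"] \<open>m < 0\<close> by (intro mult_right_mono_neg) auto
    ultimately show False
      using sum_le by linarith
  next
    case False
    have "real (card (nbrs n (i, j))) * m \<le> (\<Sum>q\<in>nbrs n (i, j). e q)"
      using sum_mono[of "nbrs n (i, j)" "\<lambda>_. m" e] e_ge by auto
    moreover have "3 * m \<le> real (card (nbrs n (i, j))) * m"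
      using card_nbrs_boundary[OF ij(1) False] \<open>m < 0\<close> by (intro mult_right_mono_neg) auto
    ultimately show False
      using sum_le \<open>m < 0\<close> by linarith
  qed
qed

text \<open>The value \<open>w c\<close> is bounded below by pairing \<open>lap n w\<close> with
  \<open>g\<close>, and above by comparing \<open>w\<close> with a multiple of \<open>g\<close> at
  the untoppled cell. Bounding \<open>U\<close> by \<open>R * g\<close> on the whole grid makes the
  result independent of the position of that cell.\<close>

lemma untoppled_bound:
  fixes U g :: "nat \<times> nat \<Rightarrow> real" and m K R :: real
  assumes bal: "balance n b z \<sigma>" and st: "stable (grid n) \<sigma>"
    and x: "x \<in> grid_cells n" "z x = 0" and c: "c \<in> grid_cells n"
    and U: "\<And>p. p \<in> grid_cells n \<Longrightarrow> 0 \<le> U p" "\<And>p. p \<in> grid_cells n \<Longrightarrow> 1 \<le> lap n U p"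
    and g: "0 < m" "\<And>p. p \<in> grid_cells n \<Longrightarrow> m \<le> g p"
      "\<And>p. p \<in> grid_cells n - {c} \<Longrightarrow> lap n g p \<le> 0" "lap n g c \<le> K"
    and R: "\<And>p. p \<in> grid_cells n \<Longrightarrow> U p \<le> R * g p" and "0 \<le> K"
  shows "m * real (\<Sum>p\<in>grid_cells n. b p) \<le> 3 * K * g c * R"
proof -
  \<comment> \<open>A stable cell holds at most 3 grains; three copies of \<open>U\<close>
    compensate for them in \<open>lap n w\<close>.\<close>
  define w where "w p = real (z p) + 3 * U p" for p
  have w_nonneg: "0 \<le> w p" if "p \<in> grid_cells n" for p
    using U(1)[OF that] by (simp add: w_def)
  have g_pos: "0 < g p" if "p \<in> grid_cells n" for p
    using g(1) g(2)[OF that] by linarith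
  have lap_w: "real (b p) \<le> lap n w p" if p: "p \<in> grid_cells n" for p
  proof -
    have "real (\<sigma> (Some p) + 4 * z p) = real (b p + (\<Sum>q\<in>nbrs n p. z q))"
      using bal p by (simp add: balance_def)
    then have "lap n (\<lambda>p. real (z p)) p = real (b p) - real (\<sigma> (Some p))"
      by (simp add: lap_def)
    moreover have "\<sigma> (Some p) < 4"
      using st p by (simp add: stable_grid_iff)
    then have "real (\<sigma> (Some p)) \<le> 3" by simp
    moreover have "lap n w p = lap n (\<lambda>p. real (z p)) p + 3 * lap n U p"
      unfolding w_def lap_add lap_cmult by (rule refl)
    ultimately show ?thesis
      using U(2)[OF p] by linarith
  qed
  have "m * real (\<Sum>p\<in>grid_cells n. b p) = (\<Sum>p\<in>grid_cells n. m * real (b p))"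
    by (simp add: sum_distrib_left)
  also have "\<dots> \<le> (\<Sum>p\<in>grid_cells n. g p * lap n w p)"
    using g lap_w g_pos by (intro sum_mono mult_mono) (auto intro: less_imp_le)
  also have "\<dots> = (\<Sum>p\<in>grid_cells n. w p * lap n g p)"
    by (rule lap_symmetric)
  also have "\<dots> = w c * lap n g c + (\<Sum>p\<in>grid_cells n - {c}. w p * lap n g p)"
    using c by (simp add: sum.remove)
  also have "\<dots> \<le> w c * K + 0"
    using w_nonneg c g(3,4)
    by (intro add_mono mult_left_mono sum_nonpos mult_nonneg_nonpos) auto
  finally have mb: "m * real (\<Sum>p\<in>grid_cells n. b p) \<le> w c * K" by simp
  \<comment> \<open>With this factor \<open>w - k * g\<close> vanishes at \<open>c\<close>, the one
    cell where \<open>g\<close> need not be subharmonic.\<close>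
  define k where "k = w c / g c"
  have "0 \<le> k"
    using w_nonneg[OF c] g_pos[OF c] by (simp add: k_def)
  have kc: "w c = k * g c"
    using g_pos[OF c] by (simp add: k_def)
  have "0 \<le> w x - k * g x"
  proof (rule minimum_principle[where c = c])
    show "0 \<le> lap n (\<lambda>p. w p - k * g p) p" if p: "p \<in> grid_cells n - {c}" for p
    proof -
      have "k * lap n g p \<le> 0"
        using \<open>0 \<le> k\<close> g(3)[OF p] by (rule mult_nonneg_nonpos)
      moreover have "0 \<le> lap n w p"
        using lap_w[of p] p by (simp add: order_trans[of 0 "real (b p)"])
      ultimately show ?thesis
        unfolding lap_diff lap_cmult by linarith
    qed
  qed (use kc x in auto)
  then have "k * g x \<le> 3 * U x"
    using x by (simp add: w_def)
  also have "\<dots> \<le> (3 * R) * g x"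
    using R[OF x(1)] by simp
  finally have "k \<le> 3 * R"
    using g_pos[OF x(1)] by simp
  then have "w c * K \<le> 3 * R * g c * K"
    unfolding kc using g_pos[OF c] \<open>0 \<le> K\<close> by (intro mult_right_mono) auto
  with mb show ?thesis
    by (simp add: mult.commute mult.left_commute)
qed

lemma tcl_grid_le:
  fixes U g :: "nat \<times> nat \<Rightarrow> real" and m K R :: real
  assumes n: "1 \<le> n" and c: "c \<in> grid_cells n"
    and U: "\<And>p. p \<in> grid_cells n \<Longrightarrow> 0 \<le> U p" "\<And>p. p \<in> grid_cells n \<Longrightarrow> 1 \<le> lap n U p"
    and g: "0 < m" "\<And>p. p \<in> grid_cells n \<Longrightarrow> m \<le> g p"
      "\<And>p. p \<in> grid_cells n - {c} \<Longrightarrow> lap n g p \<le> 0" "lap n g c \<le> K"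
    and R: "\<And>p. p \<in> grid_cells n \<Longrightarrow> U p \<le> R * g p" and K: "0 \<le> K"
  shows "tcl (grid n) \<noteq> \<infinity>" "real (the_enat (tcl (grid n))) \<le> 3 * K * g c * R / m"
proof -
  let ?T = "{t. \<exists>\<sigma>. (sandpile_step (grid n) ^^ t) empty_config \<sigma> \<and> transient (grid n) \<sigma>}"
  let ?B = "3 * K * g c * R / m"
  have "t \<le> nat \<lfloor>?B\<rfloor>" if t: "t \<in> ?T" for t
  proof -
    obtain \<sigma> where \<sigma>: "(sandpile_step (grid n) ^^ t) empty_config \<sigma>" "transient (grid n) \<sigma>"
      using t by blast
    obtain b z x where z: "balance n b z \<sigma>" "(\<Sum>p\<in>grid_cells n. b p) = t"
      "x \<in> grid_cells n" "z x = 0"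
      using transient_untoppled[OF n \<sigma>] by blast
    have "stable (grid n) \<sigma>"
      using \<sigma>(2) by (simp add: transient_def)
    from untoppled_bound[OF z(1) this z(3,4) c U g R K]
    have "m * real t \<le> 3 * K * g c * R"
      using z(2) by simp
    then have "real t \<le> ?B"
      using g(1) by (simp add: field_simps)
    then show ?thesis by (rule le_nat_floor)
  qed
  then have "x \<le> enat (nat \<lfloor>?B\<rfloor>)" if "x \<in> enat ` ?T" for x
    using that by (elim imageE) (simp only: enat_ord_simps)
  then have le: "tcl (grid n) \<le> enat (nat \<lfloor>?B\<rfloor>)"
    unfolding tcl_def by (rule Sup_least)
  then show fin: "tcl (grid n) \<noteq> \<infinity>"
    by (cases "tcl (grid n)") auto
  \<comment> \<open>The floor is below the bound as a natural number only if the bound is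
    nonnegative.\<close>
  have "0 \<le> R * g c"
    using U(1)[OF c] R[OF c] by linarith
  then have "0 \<le> ?B"
    using K g(1) by (simp add: mult.assoc mult.commute[of R])
  moreover have "the_enat (tcl (grid n)) \<le> nat \<lfloor>?B\<rfloor>"
    using le fin by (cases "tcl (grid n)") auto
  ultimately show "real (the_enat (tcl (grid n))) \<le> ?B"
    using of_nat_floor[of ?B] by linarith
qed

text \<open>Extension by 0 to the frame around the square, so that every cell has four neighbours
  and the sum over \<open>nbrs\<close> becomes a plain sum of four terms.\<close>

definition zero_off :: "nat \<Rightarrow> (nat \<times> nat \<Rightarrow> real) \<Rightarrow> nat \<times> nat \<Rightarrow> real" where
  "zero_off n h q = (if q \<in> grid_cells n then h q else 0)"

lemma sum_nbrs_four:
  assumes "(i, j) \<in> grid_cells n"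
  shows "(\<Sum>q\<in>nbrs n (i, j). h q) =
    zero_off n h (Suc i, j) + zero_off n h (i - 1, j) + zero_off n h (i, Suc j) + zero_off n h (i, j - 1)"
proof -
  have ij: "1 \<le> i" "1 \<le> j"
    using assms by (auto simp: grid_cells_def)
  let ?S = "{(Suc i, j), (i - 1, j), (i, Suc j), (i, j - 1)}"
  have "(\<Sum>q\<in>nbrs n (i, j). h q) = (\<Sum>q\<in>nbrs n (i, j). zero_off n h q)"
    by (intro sum.cong) (auto simp: nbrs_def zero_off_def)
  also have "\<dots> = (\<Sum>q\<in>?S. zero_off n h q)"
    using ij by (intro sum.mono_neutral_left) (auto simp: nbrs_def grid_adj_def zero_off_def)
  also have "\<dots> = zero_off n h (Suc i, j) + zero_off n h (i - 1, j) + zero_off n h (i, Suc j) +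
      zero_off n h (i, j - 1)"
    using ij by simp
  finally show ?thesis .
qed


section \<open>A superharmonic function\<close>

text \<open>This is \<open>N\<close> times the binary entropy of \<open>x / N\<close>, in natural
  units; it vanishes at \<open>0\<close> and \<open>N\<close>. Its second derivative is
  \<open>- N / (x * (N - x))\<close>, while its size is \<open>x * (N - x) / N\<close> up to a
  logarithm.\<close>

definition entropy :: "real \<Rightarrow> real \<Rightarrow> real" where
  "entropy N x = N * ln N - x * ln x - (N - x) * ln (N - x)"

text \<open>Sharper near 1 than \<open>ln y \<le> y - 1\<close>; the gain is the term
  \<open>1 / (2 * x)\<close> in the second difference of \<open>x * ln x\<close>.\<close>

lemma ln_le_half_diff_inverse:
  fixes y :: real
  assumes "1 \<le> y"
  shows "ln y \<le> (y - 1 / y) / 2"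
proof -
  have "(1 - 1 / 1) / 2 - ln 1 \<le> (y - 1 / y) / 2 - ln y"
  proof (rule DERIV_nonneg_imp_nondecreasing[OF assms])
    fix t :: real assume t: "1 \<le> t" "t \<le> y"
    have "((\<lambda>t. (t - 1 / t) / 2 - ln t) has_real_derivative (1 - 1 / t)\<^sup>2 / 2) (at t)"
      using t by (auto intro!: derivative_eq_intros simp: field_simps power2_eq_square)
    then show "\<exists>d. ((\<lambda>t. (t - 1 / t) / 2 - ln t) has_real_derivative d) (at t) \<and> 0 \<le> d"
      by (metis zero_le_power2 divide_nonneg_nonneg zero_le_numeral)
  qed
  then show ?thesis by simp
qed

text \<open>A discrete form of \<open>(x ln x)'' = 1 / x\<close>, up to the factor 2: regrouped
  around \<open>ln x\<close>, the upward part is at least 1 and the downward part at most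
  \<open>1 - 1 / (2 * x)\<close>.\<close>

lemma x_ln_x_second_difference:
  fixes x :: real
  assumes "1 \<le> x"
  shows "1 / (2 * x) \<le> (x + 1) * ln (x + 1) + (x - 1) * ln (x - 1) - 2 * (x * ln x)"
proof -
  have "ln (x / (x + 1)) \<le> x / (x + 1) - 1"
    using assms by (intro ln_le_minus_one) simp
  then have "1 / (x + 1) \<le> ln (x + 1) - ln x"
    using assms by (simp add: ln_div field_simps)
  then have up: "1 \<le> (x + 1) * (ln (x + 1) - ln x)"
    using assms by (simp add: field_simps)
  have down: "(x - 1) * (ln x - ln (x - 1)) \<le> 1 - 1 / (2 * x)"
  proof (cases "x = 1")
    case False
    with assms have x: "1 < x" by simp
    have "ln (x / (x - 1)) \<le> (x / (x - 1) - 1 / (x / (x - 1))) / 2"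
      using x by (intro ln_le_half_diff_inverse) (simp add: field_simps)
    then have "(x - 1) * (ln x - ln (x - 1)) \<le> (x - 1) * ((x / (x - 1) - 1 / (x / (x - 1))) / 2)"
      using x by (intro mult_left_mono) (auto simp: ln_div)
    also have "\<dots> = 1 - 1 / (2 * x)"
      using x by (simp add: field_simps)
    finally show ?thesis .
  qed simp
  from up down show ?thesis
    by (simp add: algebra_simps)
qed

lemma entropy_second_difference:
  assumes "1 \<le> x" "x \<le> N - 1"
  shows "N / (2 * (x * (N - x))) \<le> 2 * entropy N x - entropy N (x + 1) - entropy N (x - 1)"
proof -
  have "N / (2 * (x * (N - x))) = 1 / (2 * x) + 1 / (2 * (N - x))"
    using assms by (simp add: field_simps)
  moreover have "N - (x + 1) = (N - x) - 1" "N - (x - 1) = (N - x) + 1"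
    by simp_all
  ultimately show ?thesis
    using x_ln_x_second_difference[of x] x_ln_x_second_difference[of "N - x"] assms
    unfolding entropy_def by (simp add: algebra_simps)
qed

lemma x_ln_ratio_bounds:
  fixes x N :: real
  assumes "1 \<le> x" "x < N"
  shows "x * (N - x) / N \<le> x * (ln N - ln x)"
    and "x * (ln N - ln x) \<le> (1 + ln N) * (x * (N - x) / N)"
proof -
  have N: "0 < N" using assms by simp
  have "ln (x / N) \<le> x / N - 1"
    using assms N by (intro ln_le_minus_one) simp
  then have "(N - x) / N \<le> ln N - ln x"
    using assms N by (simp add: ln_div field_simps)
  then have "x * ((N - x) / N) \<le> x * (ln N - ln x)"
    using assms by (intro mult_left_mono) auto
  then show "x * (N - x) / N \<le> x * (ln N - ln x)" by simp
  have "ln (N / x) \<le> N / x - 1"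
    using assms N by (intro ln_le_minus_one) simp
  then have "x * (ln N - ln x) \<le> N - x"
    using assms N by (simp add: ln_div field_simps)
  then have "(ln N - ln x) * x / N \<le> (N - x) / N"
    using N by (simp add: divide_right_mono mult.commute)
  moreover have "(ln N - ln x) * ((N - x) / N) \<le> ln N * ((N - x) / N)"
    using assms N by (intro mult_right_mono) auto
  \<comment> \<open>A split with weights \<open>x / N\<close> and \<open>(N - x) / N\<close>: the
    first share is small because \<open>ln (N / x) \<le> N / x - 1\<close>, the second because
    \<open>ln x \<ge> 0\<close>.\<close>
  moreover have "ln N - ln x = (ln N - ln x) * x / N + (ln N - ln x) * ((N - x) / N)"
    using N by (simp add: field_simps)
  ultimately have "ln N - ln x \<le> (1 + ln N) * ((N - x) / N)"
    unfolding distrib_right mult_1 by linarith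
  then have "x * (ln N - ln x) \<le> x * ((1 + ln N) * ((N - x) / N))"
    using assms by (intro mult_left_mono) auto
  then show "x * (ln N - ln x) \<le> (1 + ln N) * (x * (N - x) / N)"
    by (simp add: mult.left_commute)
qed

lemma entropy_bounds:
  assumes "1 \<le> x" "x \<le> N - 1"
  shows "2 * (x * (N - x) / N) \<le> entropy N x"
    and "entropy N x \<le> 2 * (1 + ln N) * (x * (N - x) / N)"
proof -
  have "(N - x) * (N - (N - x)) / N = x * (N - x) / N" by simp
  note bounds = x_ln_ratio_bounds[of x N] x_ln_ratio_bounds[of "N - x" N, unfolded this]
  have "entropy N x = x * (ln N - ln x) + (N - x) * (ln N - ln (N - x))"
    by (simp add: entropy_def algebra_simps)
  then show "2 * (x * (N - x) / N) \<le> entropy N x"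
    and "entropy N x \<le> 2 * (1 + ln N) * (x * (N - x) / N)"
    using bounds assms unfolding mult.assoc by auto
qed

lemma entropy_nonneg:
  assumes "x = 0 \<or> x = N \<or> 1 \<le> x \<and> x \<le> N - 1" "0 \<le> N"
  shows "0 \<le> entropy N x"
proof (cases "x = 0 \<or> x = N")
  case True
  then show ?thesis by (auto simp: entropy_def)
next
  case False
  with assms have x: "1 \<le> x" "x \<le> N - 1" by auto
  then have "0 \<le> 2 * (x * (N - x) / N)" by simp
  with entropy_bounds(1)[OF x] show ?thesis by linarith
qed

section \<open>Product of two entropy functions\<close>

definition grid_super :: "nat \<Rightarrow> nat \<times> nat \<Rightarrow> real" where
  "grid_super n p = entropy (real n + 1) (real (fst p)) * entropy (real n + 1) (real (snd p))"

lemma entropy_nat_nonneg: "k \<le> Suc n \<Longrightarrow> 0 \<le> entropy (real n + 1) (real k)"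
  by (intro entropy_nonneg) auto

lemma grid_super_nonneg: "p \<in> grid_cells n \<Longrightarrow> 0 \<le> grid_super n p"
  by (auto simp: grid_super_def grid_cells_def intro!: mult_nonneg_nonneg entropy_nat_nonneg)

text \<open>In each direction the second difference of one factor meets the lower bound for the
  other. The two contributions are at least \<open>Y / X\<close> and \<open>X / Y\<close>, one of
  which is at least 1.\<close>

lemma lap_grid_super:
  assumes p: "p \<in> grid_cells n"
  shows "1 \<le> lap n (grid_super n) p"
proof -
  obtain i j where ij: "p = (i, j)" by (cases p)
  have bds: "1 \<le> i" "i \<le> n" "1 \<le> j" "j \<le> n"
    using p by (auto simp: ij grid_cells_def)
  let ?N = "real n + 1"
  let ?a = "\<lambda>k. entropy ?N (real k)"
  define X Y where "X = real i * (?N - real i)" and "Y = real j * (?N - real j)"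
  have pos: "0 < X" "0 < Y"
    using bds by (auto simp: X_def Y_def)
  have off: "zero_off n (grid_super n) (k, l) \<le> ?a k * ?a l" if "k \<le> Suc n" "l \<le> Suc n" for k l
    using that by (auto simp: zero_off_def grid_super_def intro!: mult_nonneg_nonneg entropy_nat_nonneg)
  have "(\<Sum>q\<in>nbrs n (i, j). grid_super n q) \<le>
      ?a (Suc i) * ?a j + ?a (i - 1) * ?a j + ?a i * ?a (Suc j) + ?a i * ?a (j - 1)"
    unfolding sum_nbrs_four[OF p[unfolded ij]] using bds by (intro add_mono off) auto
  then have lap_ge: "(2 * ?a i - ?a (Suc i) - ?a (i - 1)) * ?a j +
      ?a i * (2 * ?a j - ?a (Suc j) - ?a (j - 1)) \<le> lap n (grid_super n) p"
    by (simp add: lap_def ij grid_super_def algebra_simps)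
  have second: "?N / (2 * (real k * (?N - real k))) \<le> 2 * ?a k - ?a (Suc k) - ?a (k - 1)"
    if "1 \<le> k" "k \<le> n" for k
    using entropy_second_difference[of "real k" ?N] that by (simp add: add.commute of_nat_diff)
  have lower: "2 * (real k * (?N - real k) / ?N) \<le> ?a k" if "1 \<le> k" "k \<le> n" for k
    using that by (intro entropy_bounds(1)) auto
  have "(?N / (2 * X)) * (2 * (Y / ?N)) + (2 * (X / ?N)) * (?N / (2 * Y)) \<le>
      (2 * ?a i - ?a (Suc i) - ?a (i - 1)) * ?a j + ?a i * (2 * ?a j - ?a (Suc j) - ?a (j - 1))"
  proof (intro add_mono mult_mono)
    show "?N / (2 * X) \<le> 2 * ?a i - ?a (Suc i) - ?a (i - 1)"
      and "?N / (2 * Y) \<le> 2 * ?a j - ?a (Suc j) - ?a (j - 1)"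
      and "2 * (X / ?N) \<le> ?a i" and "2 * (Y / ?N) \<le> ?a j"
      unfolding X_def Y_def using second[of i] second[of j] lower[of i] lower[of j] bds by auto
    then show "0 \<le> 2 * ?a i - ?a (Suc i) - ?a (i - 1)"
      using pos by (intro order_trans[OF _ \<open>?N / (2 * X) \<le> _\<close>]) simp
    show "0 \<le> ?a i"
      using bds by (intro entropy_nat_nonneg) simp
  qed (use pos in auto)
  moreover have "(?N / (2 * X)) * (2 * (Y / ?N)) + (2 * (X / ?N)) * (?N / (2 * Y)) = Y / X + X / Y"
  proof -
    have "(M / (2 * X)) * (2 * (Y / M)) + (2 * (X / M)) * (M / (2 * Y)) = Y / X + X / Y"
      if "0 < M" for M
      using that pos by (simp add: field_simps)
    from this[of ?N] show ?thesis by simp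
  qed
  moreover have "1 \<le> Y / X + X / Y"
  proof (cases "X \<le> Y")
    case True
    then have "1 \<le> Y / X" "0 \<le> X / Y" using pos by auto
    then show ?thesis by linarith
  next
    case False
    then have "1 \<le> X / Y" "0 \<le> Y / X" using pos by auto
    then show ?thesis by linarith
  qed
  ultimately show ?thesis
    using lap_ge by linarith
qed

text \<open>Finiteness for every \<open>n\<close> only asks for some positive \<open>g\<close> that
  is subharmonic off one cell. For \<open>g = 4^-(i + j)\<close>, any cell other than the corner has
  a neighbour nearer to it whose value alone is \<open>4 * g p\<close>.\<close>

lemma tcl_grid_finite:
  assumes "1 \<le> n"
  shows "tcl (grid n) \<noteq> \<infinity>"
proof -
  define g :: "nat \<times> nat \<Rightarrow> real" where "g p = (1 / 4) ^ (fst p + snd p)" for p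
  define R where "R = (\<Sum>p\<in>grid_cells n. grid_super n p / g p)"
  have g_pos: "0 < g p" for p
    by (simp add: g_def)
  have c: "(1, 1) \<in> grid_cells n"
    using assms by (simp add: grid_cells_def)
  have m: "(1 / 4) ^ (2 * n) \<le> g p" if "p \<in> grid_cells n" for p
    using that by (auto simp: g_def grid_cells_def intro!: power_decreasing)
  have sub: "lap n g p \<le> 0" if p: "p \<in> grid_cells n - {(1, 1)}" for p
  proof -
    obtain i j where ij: "p = (i, j)" by (cases p)
    have "\<exists>q\<in>nbrs n p. g q = 4 * g p"
    proof (cases "i = 1")
      case True
      then obtain k where "j = Suc (Suc k)"
        using p ij by (cases j; cases "j - 1") (auto simp: grid_cells_def)
      then show ?thesis
        using p by (intro bexI[of _ "(i, Suc k)"]) (auto simp: ij g_def nbrs_def grid_adj_def grid_cells_def)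
    next
      case False
      then obtain k where "i = Suc (Suc k)"
        using p ij by (cases i; cases "i - 1") (auto simp: grid_cells_def)
      then show ?thesis
        using p by (intro bexI[of _ "(Suc k, j)"]) (auto simp: ij g_def nbrs_def grid_adj_def grid_cells_def)
    qed
    then obtain q where q: "q \<in> nbrs n p" "g q = 4 * g p" by blast
    have "g q \<le> (\<Sum>r\<in>nbrs n p. g r)"
      using q(1) g_pos by (intro member_le_sum) (auto intro: less_imp_le)
    with q(2) show ?thesis by (simp add: lap_def)
  qed
  have K: "lap n g (1, 1) \<le> 4 * g (1, 1)"
    using g_pos by (simp add: lap_def sum_nonneg less_imp_le)
  have R: "grid_super n p \<le> R * g p" if p: "p \<in> grid_cells n" for p
  proof -
    have "grid_super n p / g p \<le> R"
      unfolding R_def using p g_pos grid_super_nonneg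
      by (intro member_le_sum) (auto intro!: divide_nonneg_pos)
    then show ?thesis
      using g_pos[of p] by (simp add: field_simps)
  qed
  show ?thesis
    by (rule tcl_grid_le(1)[OF assms c grid_super_nonneg lap_grid_super _ m sub K R])
      (use g_pos in \<open>auto simp: less_imp_le\<close>)
qed


section \<open>A function subharmonic off one point\<close>

text \<open>With the shift \<open>- 1\<close>, i.e. \<open>ln (r\<^sup>2 - 1/2)\<close> up to a constant, the discretisation error of
  \<open>- ln r\<^sup>2\<close> has a sign on all of \<open>\<int>\<^sup>2\<close>.\<close>

definition log_pot :: "int \<Rightarrow> int \<Rightarrow> real" where
  "log_pot a b = (if a = 0 \<and> b = 0 then 6 else - ln (real_of_int (2 * (a\<^sup>2 + b\<^sup>2) - 1)))"

lemma log_pot_away: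
  "\<not> (a = 0 \<and> b = 0) \<Longrightarrow> log_pot a b = - ln (real_of_int (2 * (a\<^sup>2 + b\<^sup>2) - 1))"
  unfolding log_pot_def by (rule if_not_P)

lemma log_pot_arg_pos:
  fixes a b :: int
  assumes "\<not> (a = 0 \<and> b = 0)"
  shows "0 < real_of_int (2 * (a\<^sup>2 + b\<^sup>2) - 1)"
proof -
  have "0 < a\<^sup>2 + b\<^sup>2"
    using assms by (simp add: sum_power2_gt_zero_iff)
  moreover have "0 < 2 * k - 1" if "0 < k" for k :: int
    using that by linarith
  ultimately have "0 < 2 * (a\<^sup>2 + b\<^sup>2) - 1" by blast
  then show ?thesis by (simp only: of_int_0_less_iff)
qed

text \<open>Next to the origin \<open>log_pot\<close> is 0, and its neighbours have the values 6,
  \<open>- ln 7\<close>, \<open>- ln 3\<close>, \<open>- ln 3\<close>; this is why the pole is given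
  the height 6.\<close>

lemma ln_7_3_3_le: "ln 7 + ln 3 + ln 3 \<le> (6 :: real)"
proof -
  have "ln 7 + ln 3 + ln 3 = ln (7 * 3 * 3 :: real)"
    by (simp only: ln_mult_pos zero_less_numeral mult_pos_pos)
  also have "\<dots> \<le> ln (2 ^ 6)"
    by (subst ln_le_cancel_iff) auto
  also have "\<dots> = 6 * ln 2"
    by (subst ln_realpow) auto
  also have "\<dots> \<le> 6"
    using ln_le_minus_one[of 2] by simp
  finally show ?thesis .
qed

text \<open>Away from the pole the product of the four neighbouring arguments is at most
  \<open>S ^ 4\<close>. With \<open>x^2 + y^2 = (S + 1) / 2\<close> it equals
  \<open>((S + 2)^2 - 4 * (S + 1))^2 - 64 * (x^2 - y^2)^2\<close>, and the first square is exactly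
  \<open>S ^ 4\<close>.\<close>

lemma log_pot_subharmonic:
  assumes ab: "\<not> (a = 0 \<and> b = 0)"
  shows "4 * log_pot a b \<le> log_pot (a + 1) b + log_pot (a - 1) b + log_pot a (b + 1) + log_pot a (b - 1)"
proof (cases "\<bar>a\<bar> + \<bar>b\<bar> = 1")
  case True
  then have "(a, b) \<in> {(1, 0), (- 1, 0), (0, 1), (0, - 1)}" by auto
  then show ?thesis
    using ln_7_3_3_le by (auto simp: log_pot_def)
next
  case False
  have nz: "\<not> (a + 1 = 0 \<and> b = 0)" "\<not> (a - 1 = 0 \<and> b = 0)" "\<not> (a = 0 \<and> b + 1 = 0)"
    "\<not> (a = 0 \<and> b - 1 = 0)"
    using ab False by auto
  define x y S where "x = real_of_int a" and "y = real_of_int b" and "S = 2 * (x\<^sup>2 + y\<^sup>2) - 1"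
  have args: "real_of_int (2 * (a\<^sup>2 + b\<^sup>2) - 1) = S"
    "real_of_int (2 * ((a + 1)\<^sup>2 + b\<^sup>2) - 1) = S + 2 + 4 * x"
    "real_of_int (2 * ((a - 1)\<^sup>2 + b\<^sup>2) - 1) = S + 2 - 4 * x"
    "real_of_int (2 * (a\<^sup>2 + (b + 1)\<^sup>2) - 1) = S + 2 + 4 * y"
    "real_of_int (2 * (a\<^sup>2 + (b - 1)\<^sup>2) - 1) = S + 2 - 4 * y"
    by (simp_all add: S_def x_def y_def power2_eq_square algebra_simps)
  note pos = log_pot_arg_pos[OF ab, unfolded args] log_pot_arg_pos[OF nz(1), unfolded args]
    log_pot_arg_pos[OF nz(2), unfolded args] log_pot_arg_pos[OF nz(3), unfolded args]
    log_pot_arg_pos[OF nz(4), unfolded args]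
  have "(S + 2 + 4 * x) * (S + 2 - 4 * x) * (S + 2 + 4 * y) * (S + 2 - 4 * y) =
      S ^ 4 - 64 * (x\<^sup>2 - y\<^sup>2)\<^sup>2"
    unfolding S_def by (simp add: power2_eq_square power4_eq_xxxx algebra_simps)
  also have "\<dots> \<le> S ^ 4" by simp
  finally have "ln ((S + 2 + 4 * x) * (S + 2 - 4 * x) * (S + 2 + 4 * y) * (S + 2 - 4 * y)) \<le> ln (S ^ 4)"
    using pos by (subst ln_le_cancel_iff) (auto intro!: mult_pos_pos)
  also have "\<dots> = 4 * ln S"
    using pos by (subst ln_realpow) auto
  finally have "ln (S + 2 + 4 * x) + ln (S + 2 - 4 * x) + ln (S + 2 + 4 * y) + ln (S + 2 - 4 * y) \<le> 4 * ln S"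
    using pos by (simp add: ln_mult)
  then show ?thesis
    unfolding log_pot_away[OF ab] nz[THEN log_pot_away] args by linarith
qed

text \<open>On \<open>[0, N]\<close>, \<open>weight\<close> grows linearly from both ends, and \<open>-weight''/weight\<close> in the middle is
  at most \<open>weight''/weight\<close> near the ends. So the product of two weights is subharmonic
  outside a disc that lies inside the square.\<close>

definition weight :: "real \<Rightarrow> real \<Rightarrow> real" where
  "weight N x = N\<^sup>2 * (x * (N - x)) + 40 * (x * (N - x))\<^sup>2"

definition weight_diff :: "real \<Rightarrow> real \<Rightarrow> real" where
  "weight_diff N x = weight N (x + 1) + weight N (x - 1) - 2 * weight N x"

lemma weight_diff_eq: "weight_diff N x = 78 * N\<^sup>2 + 80 - 480 * (x * (N - x))"
  unfolding weight_diff_def weight_def by (simp add: power2_eq_square algebra_simps)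

lemma parabola_bounds:
  fixes x N :: real
  assumes "0 \<le> x" "x \<le> N"
  shows "0 \<le> x * (N - x)" "x * (N - x) \<le> N\<^sup>2 / 4"
proof -
  show "0 \<le> x * (N - x)" using assms by simp
  have "N\<^sup>2 / 4 - x * (N - x) = (N / 2 - x)\<^sup>2"
    by (simp add: power2_eq_square field_simps)
  then show "x * (N - x) \<le> N\<^sup>2 / 4"
    by (metis diff_ge_0_iff_ge zero_le_power2)
qed

lemma weight_ge:
  "N\<^sup>2 * (x * (N - x)) \<le> weight N x"
  unfolding weight_def by simp

lemma weight_nonneg: "0 \<le> x \<Longrightarrow> x \<le> N \<Longrightarrow> 0 \<le> weight N x"
  by (simp add: weight_def)

lemma weight_le:
  assumes "0 \<le> x" "x \<le> N"
  shows "weight N x \<le> 11 / 4 * N ^ 4"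
proof -
  have "weight N x \<le> N\<^sup>2 * (N\<^sup>2 / 4) + 40 * (N\<^sup>2 / 4)\<^sup>2"
    unfolding weight_def using parabola_bounds[OF assms]
    by (intro add_mono mult_left_mono power_mono) auto
  also have "\<dots> = 11 / 4 * N ^ 4"
    by (simp add: power2_eq_square power4_eq_xxxx)
  finally show ?thesis .
qed

text \<open>Written in the deficit \<open>v \<ge> 0\<close> of \<open>x * (N - x)\<close> from its
  maximum, the difference of the two sides has only nonnegative coefficients. The rate 16 matches
  the one in \<open>weight_diff_ge_pos\<close>.\<close>

lemma weight_diff_ge_neg:
  assumes "0 \<le> x" "x \<le> N"
  shows "- 16 * weight N x \<le> N\<^sup>2 * weight_diff N x"
proof -
  define v where "v = N\<^sup>2 / 4 - x * (N - x)"
  have v: "x * (N - x) = N\<^sup>2 / 4 - v" "0 \<le> v"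
    using parabola_bounds(2)[OF assms] by (auto simp: v_def)
  have "N\<^sup>2 * weight_diff N x + 16 * weight N x = 2 * (N\<^sup>2)\<^sup>2 + 80 * N\<^sup>2 + 144 * (N\<^sup>2 * v) + 640 * v\<^sup>2"
    unfolding weight_diff_eq weight_def v(1) by (simp add: power2_eq_square algebra_simps)
  also have "0 \<le> \<dots>" using v(2) by simp
  finally show ?thesis by linarith
qed

text \<open>In units of \<open>N ^ 4\<close>, even at \<open>w = 13 / 100 * N^2\<close> there
  remains 78 - 64.48 - 10.816 > 0.\<close>

lemma weight_diff_ge_pos:
  assumes "0 \<le> x" "x \<le> N" and small: "x * (N - x) \<le> 13 / 100 * N\<^sup>2"
  shows "16 * weight N x \<le> N\<^sup>2 * weight_diff N x"
proof -
  define w where "w = x * (N - x)"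
  have w: "0 \<le> w" "w \<le> 13 / 100 * N\<^sup>2"
    using parabola_bounds(1)[OF assms(1,2)] small by (auto simp: w_def)
  have "N\<^sup>2 * w \<le> N\<^sup>2 * (13 / 100 * N\<^sup>2)"
    using w by (intro mult_left_mono) auto
  then have "N\<^sup>2 * w \<le> 13 / 100 * (N\<^sup>2)\<^sup>2"
    by (simp add: power2_eq_square)
  moreover have "w\<^sup>2 \<le> (13 / 100 * N\<^sup>2)\<^sup>2"
    using w by (intro power_mono)
  then have "w\<^sup>2 \<le> 169 / 10000 * (N\<^sup>2)\<^sup>2"
    by (simp add: power_mult_distrib power2_eq_square)
  moreover have "0 \<le> (N\<^sup>2)\<^sup>2" "0 \<le> N\<^sup>2" by simp_all
  moreover have "N\<^sup>2 * weight_diff N x - 16 * weight N x =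
      78 * (N\<^sup>2)\<^sup>2 + 80 * N\<^sup>2 - 496 * (N\<^sup>2 * w) - 640 * w\<^sup>2"
    unfolding weight_diff_eq weight_def w_def[symmetric] by (simp add: power2_eq_square algebra_simps)
  ultimately show ?thesis by linarith
qed

text \<open>By \<open>far\<close> the two parabolas add up to at most \<open>26 / 100 * N^2\<close>,
  so one is at most \<open>13 / 100 * N^2\<close>. The gain at rate 16 in that direction covers the
  loss at rate 16 in the other.\<close>

lemma weight_product_subharmonic:
  assumes x: "0 \<le> x" "x \<le> N" and y: "0 \<le> y" "y \<le> N" and N: "0 < N"
    and far: "96 / 100 * N\<^sup>2 \<le> (2 * x - N)\<^sup>2 + (2 * y - N)\<^sup>2"
  shows "0 \<le> weight_diff N x * weight N y + weight N x * weight_diff N y"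
proof -
  have main: "0 \<le> N\<^sup>2 * (weight_diff N x * weight N y + weight N x * weight_diff N y)"
    if x: "0 \<le> x" "x \<le> N" and y: "0 \<le> y" "y \<le> N" and "x * (N - x) \<le> 13 / 100 * N\<^sup>2" for x y
  proof -
    have "16 * weight N x * weight N y \<le> N\<^sup>2 * weight_diff N x * weight N y"
      using weight_diff_ge_pos[OF x that(5)] weight_nonneg[OF y] by (intro mult_right_mono)
    moreover have "weight N x * (- 16 * weight N y) \<le> weight N x * (N\<^sup>2 * weight_diff N y)"
      using weight_diff_ge_neg[OF y] weight_nonneg[OF x] by (intro mult_left_mono)
    ultimately show ?thesis by (simp add: algebra_simps)
  qed
  have "(2 * x - N)\<^sup>2 + (2 * y - N)\<^sup>2 = 2 * N\<^sup>2 - 4 * (x * (N - x)) - 4 * (y * (N - y))"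
    by (simp add: power2_eq_square algebra_simps)
  with far have "x * (N - x) \<le> 13 / 100 * N\<^sup>2 \<or> y * (N - y) \<le> 13 / 100 * N\<^sup>2" by linarith
  then have "0 \<le> N\<^sup>2 * (weight_diff N x * weight N y + weight N x * weight_diff N y)"
    using main[OF x y] main[OF y x] by (auto simp: algebra_simps)
  then show ?thesis
    using N by (simp add: zero_le_mult_iff)
qed

section \<open>Gluing the logarithmic pole and the product of weights\<close>

locale large_grid =
  fixes n :: nat
  assumes n_large: "1000 \<le> n"
begin

definition side :: real where "side = real n + 1"
definition mid :: nat where "mid = Suc n div 2"

text \<open>The additive constant is \<open>ln (2 * r^2 - 1)\<close> for
  \<open>r = (side - 1) / 2\<close>, a lower bound for the distance from the centre to the frame; it
  makes \<open>log_part\<close> at most 0 on the frame.\<close>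

definition log_part :: "nat \<Rightarrow> nat \<Rightarrow> real" where
  "log_part i j = ln ((side - 1)\<^sup>2 / 2 - 1) + log_pot (int i - int mid) (int j - int mid)"

definition product_part :: "nat \<Rightarrow> nat \<Rightarrow> real" where
  "product_part i j = weight side (real i) * weight side (real j) / (1000 * side ^ 8)"

text \<open>Each part wins only where it is subharmonic: inside the disc of
  \<open>log_part_near\<close> the pole is at least 1/100, which the normalised product never
  exceeds.\<close>

definition sub :: "nat \<times> nat \<Rightarrow> real" where
  "sub p = max (log_part (fst p) (snd p)) (product_part (fst p) (snd p))"

lemma side_large: "1001 \<le> side"
  using n_large by (simp add: side_def)

lemma mid_bounds: "side - 1 \<le> 2 * real mid" "2 * real mid \<le> side"
proof -
  have "n \<le> 2 * mid" "2 * mid \<le> Suc n"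
    unfolding mid_def by auto
  then show "side - 1 \<le> 2 * real mid" "2 * real mid \<le> side"
    unfolding side_def by linarith+
qed

lemma mid_in_grid: "(mid, mid) \<in> grid_cells n"
  using n_large by (auto simp: grid_cells_def mid_def)

lemma log_const_pos: "1 \<le> (side - 1)\<^sup>2 / 2 - 1"
proof -
  have "1000\<^sup>2 \<le> (side - 1)\<^sup>2"
    using side_large by (intro power_mono) auto
  then show ?thesis by simp
qed

lemma log_part_off_grid:
  assumes "i = 0 \<or> i = Suc n \<or> j = 0 \<or> j = Suc n"
  shows "log_part i j \<le> 0"
proof -
  let ?a = "real i - real mid" and ?b = "real j - real mid"
  have far: "((side - 1) / 2)\<^sup>2 \<le> (real k - real mid)\<^sup>2" if "k = 0 \<or> k = Suc n" for k
  proof -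
    have "(side - 1) / 2 \<le> \<bar>real k - real mid\<bar>"
      using that mid_bounds by (auto simp: side_def)
    then have "((side - 1) / 2)\<^sup>2 \<le> \<bar>real k - real mid\<bar>\<^sup>2"
      using side_large by (intro power_mono) auto
    then show ?thesis by simp
  qed
  have "((side - 1) / 2)\<^sup>2 \<le> ?a\<^sup>2 + ?b\<^sup>2"
    using assms far[of i] far[of j] zero_le_power2[of ?a] zero_le_power2[of ?b] by linarith
  then have arg: "(side - 1)\<^sup>2 / 2 - 1 \<le> 2 * (?a\<^sup>2 + ?b\<^sup>2) - 1"
    by (simp add: power_divide)
  have nz: "\<not> (int i - int mid = 0 \<and> int j - int mid = 0)"
    using assms n_large by (auto simp: mid_def)
  show ?thesis
    unfolding log_part_def log_pot_away[OF nz] using arg log_const_pos by simp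
qed

text \<open>The disc has squared radius 0.24 \<open>side^2\<close>, against about 0.25 for the zero
  level of \<open>log_part\<close>. The margin absorbs the shift from the true centre
  \<open>side / 2\<close> to \<open>mid\<close> and leaves a ratio of at most 99/100, hence a
  logarithm of at most - 1/100.\<close>

lemma log_part_near:
  assumes ij: "i \<le> Suc n" "j \<le> Suc n"
    and near: "(2 * real i - side)\<^sup>2 + (2 * real j - side)\<^sup>2 < 96 / 100 * side\<^sup>2"
  shows "1 / 100 \<le> log_part i j"
proof (cases "i = mid \<and> j = mid")
  case True
  then show ?thesis
    using ln_ge_zero[OF log_const_pos] by (simp add: log_part_def log_pot_def)
next
  case False
  then have nz: "\<not> (int i - int mid = 0 \<and> int j - int mid = 0)" by auto
  define A where "A = (side - 1)\<^sup>2 / 2 - 1"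
  define D where "D = 2 * ((real i - real mid)\<^sup>2 + (real j - real mid)\<^sup>2) - 1"
  define \<delta> u v where "\<delta> = side - 2 * real mid" and "u = 2 * real i - side" and "v = 2 * real j - side"
  have D_eq: "real_of_int (2 * ((int i - int mid)\<^sup>2 + (int j - int mid)\<^sup>2) - 1) = D"
    by (simp add: D_def)
  have D_pos: "0 < D"
    using log_pot_arg_pos[OF nz] unfolding D_eq .
  have \<delta>: "0 \<le> \<delta>" "\<delta> \<le> 1"
    using mid_bounds by (auto simp: \<delta>_def)
  have uv: "u + v \<le> 2 * side"
    using ij by (simp add: u_def v_def side_def)
  have "\<delta> * (u + v) \<le> \<delta> * (2 * side)"
    using uv \<delta> by (intro mult_left_mono)
  also have "\<dots> \<le> 1 * (2 * side)"
    using \<delta> side_large by (intro mult_right_mono) auto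
  finally have d1: "\<delta> * (u + v) \<le> 2 * side" by simp
  have d2: "\<delta>\<^sup>2 \<le> 1"
    using \<delta> by (simp add: power_le_one)
  have "2 * (D + 1) = (u + \<delta>)\<^sup>2 + (v + \<delta>)\<^sup>2"
    by (simp add: D_def u_def v_def \<delta>_def power2_eq_square algebra_simps)
  also have "\<dots> = u\<^sup>2 + v\<^sup>2 + 2 * (\<delta> * (u + v)) + 2 * \<delta>\<^sup>2"
    by (simp add: power2_eq_square algebra_simps)
  also have "\<dots> \<le> 96 / 100 * side\<^sup>2 + 2 * (2 * side) + 2 * 1"
    using near d1 d2 unfolding u_def[symmetric] v_def[symmetric]
    by (intro add_mono mult_left_mono) auto
  finally have "2 * D \<le> 96 / 100 * side\<^sup>2 + 4 * side"
    by simp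
  moreover have A_eq: "A = side\<^sup>2 / 2 - side - 1 / 2"
    by (simp add: A_def power2_eq_square field_simps)
  \<comment> \<open>The size of the grid enters here: terms linear in \<open>side\<close> are small
    against \<open>side^2\<close>.\<close>
  moreover have "1001 * side \<le> side\<^sup>2"
    using side_large by (simp add: power2_eq_square)
  ultimately have DA: "D \<le> 99 / 100 * A"
    using side_large by linarith
  have "1 \<le> A"
    using log_const_pos by (simp add: A_def)
  then have "ln (D / A) \<le> D / A - 1"
    using D_pos by (intro ln_le_minus_one) simp
  also have "D / A \<le> 99 / 100"
    using DA \<open>1 \<le> A\<close> by (simp add: field_simps)
  finally have "ln D - ln A \<le> - 1 / 100"
    using D_pos \<open>1 \<le> A\<close> by (simp add: ln_div)
  then show ?thesis
    unfolding log_part_def log_pot_away[OF nz] D_eq A_def[symmetric] by linarith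
qed

lemma product_part_off_grid:
  "i = 0 \<or> i = Suc n \<or> j = 0 \<or> j = Suc n \<Longrightarrow> product_part i j = 0"
  by (auto simp: product_part_def weight_def side_def)

lemma product_part_le:
  assumes "i \<le> Suc n" "j \<le> Suc n"
  shows "product_part i j \<le> 1 / 100"
proof -
  have "weight side (real i) * weight side (real j) \<le> (11 / 4 * side ^ 4) * (11 / 4 * side ^ 4)"
    using assms by (intro mult_mono weight_le weight_nonneg) (auto simp: side_def)
  also have "\<dots> = 121 / 16 * side ^ 8"
    by (simp flip: power_add)
  finally have "product_part i j \<le> (121 / 16 * side ^ 8) / (1000 * side ^ 8)"
    unfolding product_part_def using side_large by (intro divide_right_mono) auto
  also have "\<dots> \<le> 1 / 100"
    using side_large by simp
  finally show ?thesis .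
qed

text \<open>On the frame both parts are at most 0, so the extension of \<open>sub\<close> by 0 still
  dominates each of them there.\<close>

lemma zero_off_sub_ge:
  assumes "i \<le> Suc n" "j \<le> Suc n"
  shows "log_part i j \<le> zero_off n sub (i, j)" "product_part i j \<le> zero_off n sub (i, j)"
proof -
  have "i = 0 \<or> i = Suc n \<or> j = 0 \<or> j = Suc n" if "(i, j) \<notin> grid_cells n"
    using that assms by (auto simp: grid_cells_def)
  then show "log_part i j \<le> zero_off n sub (i, j)" "product_part i j \<le> zero_off n sub (i, j)"
    using log_part_off_grid[of i j] product_part_off_grid[of i j] by (auto simp: zero_off_def sub_def)
qed

lemma sum_nbrs_sub_ge:
  assumes "(i, j) \<in> grid_cells n" and "f = log_part \<or> f = product_part"
  shows "f (Suc i) j + f (i - 1) j + f i (Suc j) + f i (j - 1) \<le> (\<Sum>q\<in>nbrs n (i, j). sub q)"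
  unfolding sum_nbrs_four[OF assms(1)]
  using assms by (intro add_mono) (auto simp: grid_cells_def intro!: zero_off_sub_ge)

text \<open>At each cell the part that attains the maximum is subharmonic, and its neighbour sum is
  at most that of \<open>sub\<close>. If the product wins, \<open>log_part\<close> is below 1/100
  and the cell lies outside the disc.\<close>

lemma lap_sub_nonpos:
  assumes p: "p \<in> grid_cells n - {(mid, mid)}"
  shows "lap n sub p \<le> 0"
proof -
  obtain i j where ij: "p = (i, j)" by (cases p)
  have cell: "(i, j) \<in> grid_cells n" and bds: "1 \<le> i" "i \<le> n" "1 \<le> j" "j \<le> n"
    using p by (auto simp: ij grid_cells_def)
  show ?thesis
  proof (cases "sub p = log_part i j")
    case True
    have "\<not> (int i - int mid = 0 \<and> int j - int mid = 0)"
      using p by (auto simp: ij)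
    from log_pot_subharmonic[OF this]
    have "4 * log_part i j \<le> log_part (Suc i) j + log_part (i - 1) j + log_part i (Suc j) + log_part i (j - 1)"
      using bds by (simp add: log_part_def of_nat_diff algebra_simps)
    with sum_nbrs_sub_ge[OF cell, of log_part] True show ?thesis
      by (simp add: lap_def ij)
  next
    case False
    then have eq: "sub p = product_part i j" and "log_part i j < product_part i j"
      by (auto simp: sub_def ij max_def split: if_splits)
    then have "log_part i j < 1 / 100"
      using product_part_le[of i j] bds by simp
    then have far: "96 / 100 * side\<^sup>2 \<le> (2 * real i - side)\<^sup>2 + (2 * real j - side)\<^sup>2"
      using log_part_near[of i j] bds by force
    have "0 \<le> (weight_diff side (real i) * weight side (real j) +
        weight side (real i) * weight_diff side (real j)) / (1000 * side ^ 8)"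
      using side_large bds far
      by (intro divide_nonneg_nonneg weight_product_subharmonic) (auto simp: side_def)
    also have "\<dots> = product_part (Suc i) j + product_part (i - 1) j + product_part i (Suc j) +
        product_part i (j - 1) - 4 * product_part i j"
    proof -
      have shift: "real (i - 1) = real i - 1" "real (j - 1) = real j - 1"
        "real (Suc i) = real i + 1" "real (Suc j) = real j + 1"
        using bds by simp_all
      have "((A\<^sub>1 + A\<^sub>2 - 2 * A) * B + A * (B\<^sub>1 + B\<^sub>2 - 2 * B)) / k =
          A\<^sub>1 * B / k + A\<^sub>2 * B / k + A * B\<^sub>1 / k + A * B\<^sub>2 / k - 4 * (A * B / k)"
        for A\<^sub>1 A\<^sub>2 A B\<^sub>1 B\<^sub>2 B k :: real
        by (simp add: divide_inverse algebra_simps)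
      then show ?thesis
        unfolding product_part_def weight_diff_def shift .
    qed
    finally show ?thesis
      using sum_nbrs_sub_ge[OF cell, of product_part] eq by (simp add: lap_def ij)
  qed
qed

lemma sub_mid: "sub (mid, mid) = ln ((side - 1)\<^sup>2 / 2 - 1) + 6"
proof -
  have "product_part mid mid \<le> 1 / 100"
    by (rule product_part_le) (auto simp: mid_def)
  then show ?thesis
    using ln_ge_zero[OF log_const_pos] by (simp add: sub_def log_part_def log_pot_def)
qed

text \<open>The bound is 4 times the height 6 of the pole, since \<open>log_pot\<close> is 0 at the
  four neighbours of the origin.\<close>

lemma lap_sub_mid: "lap n sub (mid, mid) \<le> 24"
proof -
  have "1 \<le> mid" using n_large by (simp add: mid_def)
  then have "log_part (Suc mid) mid + log_part (mid - 1) mid + log_part mid (Suc mid) + log_part mid (mid - 1)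
      = 4 * ln ((side - 1)\<^sup>2 / 2 - 1)"
    by (simp add: log_part_def log_pot_def of_nat_diff)
  then show ?thesis
    using sum_nbrs_sub_ge[OF mid_in_grid, of log_part] by (simp add: lap_def sub_mid)
qed

lemma sub_mid_le: "sub (mid, mid) \<le> 2 * ln side + 6"
proof -
  have "(side - 1)\<^sup>2 / 2 - 1 \<le> side\<^sup>2"
    using side_large by (simp add: power2_eq_square algebra_simps)
  then have "ln ((side - 1)\<^sup>2 / 2 - 1) \<le> ln (side\<^sup>2)"
    using log_const_pos by (subst ln_le_cancel_iff) auto
  also have "\<dots> = 2 * ln side"
    using side_large by (simp add: ln_realpow)
  finally show ?thesis
    by (simp add: sub_mid)
qed

lemma sub_ge:
  assumes "(i, j) \<in> grid_cells n"
  shows "(real i * (side - real i)) * (real j * (side - real j)) / (1000 * side ^ 4) \<le> sub (i, j)"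
proof -
  have bds: "1 \<le> i" "i \<le> n" "1 \<le> j" "j \<le> n"
    using assms by (auto simp: grid_cells_def)
  have "(side\<^sup>2 * (real i * (side - real i))) * (side\<^sup>2 * (real j * (side - real j))) \<le>
      weight side (real i) * weight side (real j)"
    using bds by (intro mult_mono weight_ge weight_nonneg) (auto simp: side_def)
  then have "(side\<^sup>2 * (real i * (side - real i))) * (side\<^sup>2 * (real j * (side - real j))) / (1000 * side ^ 8)
      \<le> product_part i j"
    unfolding product_part_def using side_large by (intro divide_right_mono) auto
  moreover have "(side\<^sup>2 * X) * (side\<^sup>2 * Y) / (1000 * side ^ 8) = X * Y / (1000 * side ^ 4)" for X Y
  proof -
    have "(side\<^sup>2 * X) * (side\<^sup>2 * Y) / (1000 * side ^ 8) = side ^ 4 * (X * Y) / (side ^ 4 * (1000 * side ^ 4))"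
      by (simp add: power2_eq_square eval_nat_numeral ac_simps)
    then show ?thesis using side_large by simp
  qed
  ultimately show ?thesis by (simp add: sub_def)
qed

lemma sub_ge_min:
  assumes "p \<in> grid_cells n"
  shows "1 / (4000 * side\<^sup>2) \<le> sub p"
proof -
  obtain i j where ij: "p = (i, j)" by (cases p)
  \<comment> \<open>From \<open>(k - 1) * (n - k) \<ge> 0\<close> follows
    \<open>k * (n + 1 - k) \<ge> n\<close>, which is at least half of \<open>side\<close>.\<close>
  have half: "side / 2 \<le> real k * (side - real k)" if k: "1 \<le> k" "k \<le> n" for k
  proof -
    have "0 \<le> (real k - 1) * (real n - real k)"
      using k by simp
    then have "real n \<le> real k * (side - real k)"
      by (simp add: side_def algebra_simps)
    then show ?thesis using n_large by (simp add: side_def)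
  qed
  have "1 / (4000 * side\<^sup>2) = (side / 2) * (side / 2) / (1000 * side ^ 4)"
    using side_large by (simp add: power2_eq_square power4_eq_xxxx field_simps)
  also have "\<dots> \<le> (real i * (side - real i)) * (real j * (side - real j)) / (1000 * side ^ 4)"
    using assms side_large half[of i] half[of j]
    by (intro divide_right_mono mult_mono) (auto simp: ij grid_cells_def side_def)
  also have "\<dots> \<le> sub p"
    using sub_ge assms by (simp add: ij)
  finally show ?thesis .
qed

text \<open>The upper bound for \<open>grid_super\<close> and the lower bound for \<open>sub\<close>
  are both multiples of \<open>?X * ?Y\<close>, so their ratio is uniform over the grid, up to its
  boundary.\<close>

lemma grid_super_le_sub:
  assumes "p \<in> grid_cells n"
  shows "grid_super n p \<le> (4000 * (1 + ln side)\<^sup>2 * side\<^sup>2) * sub p"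
proof -
  obtain i j where ij: "p = (i, j)" by (cases p)
  have bds: "1 \<le> i" "i \<le> n" "1 \<le> j" "j \<le> n"
    using assms by (auto simp: ij grid_cells_def)
  let ?X = "real i * (side - real i)" and ?Y = "real j * (side - real j)"
  have ent: "entropy side (real k) \<le> 2 * (1 + ln side) * (real k * (side - real k) / side)"
    if "1 \<le> k" "k \<le> n" for k
    using that by (intro entropy_bounds(2)) (auto simp: side_def)
  have "0 \<le> ln side" using side_large by simp
  then have "grid_super n p \<le> (2 * (1 + ln side) * (?X / side)) * (2 * (1 + ln side) * (?Y / side))"
    unfolding grid_super_def ij fst_conv snd_conv side_def[symmetric]
    using bds ent[of i] ent[of j] entropy_nat_nonneg[of j n] side_large
    by (intro mult_mono) (auto simp: side_def)
  also have "\<dots> = (4000 * (1 + ln side)\<^sup>2 * side\<^sup>2) * (?X * ?Y / (1000 * side ^ 4))"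
    using side_large by (simp add: power2_eq_square power4_eq_xxxx field_simps)
  also have "\<dots> \<le> (4000 * (1 + ln side)\<^sup>2 * side\<^sup>2) * sub p"
    using sub_ge assms by (intro mult_left_mono) (auto simp: ij)
  finally show ?thesis .
qed

section \<open>Growth of the bound\<close>

lemma tcl_le:
  "real (the_enat (tcl (grid n))) \<le>
    3 * 24 * (2 * ln side + 6) * (4000 * (1 + ln side)\<^sup>2 * side\<^sup>2) / (1 / (4000 * side\<^sup>2))"
proof -
  have "real (the_enat (tcl (grid n))) \<le>
      3 * 24 * sub (mid, mid) * (4000 * (1 + ln side)\<^sup>2 * side\<^sup>2) / (1 / (4000 * side\<^sup>2))"
    by (rule tcl_grid_le(2)[OF _ mid_in_grid grid_super_nonneg lap_grid_super _ sub_ge_min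
          lap_sub_nonpos lap_sub_mid grid_super_le_sub])
      (use n_large side_large in auto)
  also have "\<dots> \<le> 3 * 24 * (2 * ln side + 6) * (4000 * (1 + ln side)\<^sup>2 * side\<^sup>2) / (1 / (4000 * side\<^sup>2))"
    using sub_mid_le side_large by (intro divide_right_mono mult_right_mono) auto
  finally show ?thesis .
qed

lemma tcl_le_growth:
  "real (the_enat (tcl (grid n))) \<le>
    (3 * 24 * 10 * 4000 * 9 * 4000 * 16) * (real n ^ 4 * ln (real n) ^ 4)"
proof -
  let ?l = "ln (real n)"
  have "exp 1 \<le> (3 :: real)" by (rule exp_le)
  also have "\<dots> \<le> real n" using n_large by simp
  finally have l: "1 \<le> ?l"
    using n_large by (subst ln_ge_iff) auto
  have side: "1 \<le> side" "side \<le> 2 * real n"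
    using n_large by (auto simp: side_def)
  have "side \<le> real n ^ 2"
    using side(2) n_large by (simp add: power2_eq_square order_trans[of side "2 * real n"])
  then have "ln side \<le> ln (real n ^ 2)"
    using side by (subst ln_le_cancel_iff) auto
  then have ls: "ln side \<le> 2 * ?l" "0 \<le> ln side"
    using n_large side by (auto simp: ln_realpow)
  have "3 * 24 * (2 * ln side + 6) * (4000 * (1 + ln side)\<^sup>2 * side\<^sup>2) / (1 / (4000 * side\<^sup>2)) =
      (3 * 24 * 4000 * 4000) * ((2 * ln side + 6) * (1 + ln side)\<^sup>2 * side ^ 4)"
    by (simp add: power2_eq_square power4_eq_xxxx)
  \<comment> \<open>Here \<open>ln side \<le> 2 * ?l\<close> and \<open>1 \<le> ?l\<close> give
    \<open>2 * ln side + 6 \<le> 10 * ?l\<close> and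
    \<open>1 + ln side \<le> 3 * ?l\<close>.\<close>
  also have "\<dots> \<le> (3 * 24 * 4000 * 4000) * ((10 * ?l) * (3 * ?l)\<^sup>2 * (2 * real n) ^ 4)"
    using ls l side by (intro mult_left_mono mult_mono power_mono) auto
  also have "\<dots> = (3 * 24 * 10 * 4000 * 9 * 4000 * 16) * (real n ^ 4 * ?l ^ 3)"
    by (simp add: power_mult_distrib power2_eq_square power3_eq_cube)
  \<comment> \<open>The third power of the logarithm is relaxed to the fourth.\<close>
  also have "\<dots> \<le> (3 * 24 * 10 * 4000 * 9 * 4000 * 16) * (real n ^ 4 * ?l ^ 4)"
    using l by (intro mult_left_mono power_increasing) auto
  finally show ?thesis
    using tcl_le by linarith
qed

end

theorem mainTheorem1:
  shows "(\<forall>n\<ge>1. tcl (grid n) \<noteq> \<infinity>) \<and>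
    (\<lambda>n. real (the_enat (tcl (grid n)))) \<in> O(\<lambda>n. real n ^ 4 * ln (real n) ^ 4)"
proof
  show "\<forall>n\<ge>1. tcl (grid n) \<noteq> \<infinity>"
    using tcl_grid_finite by blast
  show "(\<lambda>n. real (the_enat (tcl (grid n)))) \<in> O(\<lambda>n. real n ^ 4 * ln (real n) ^ 4)"
  proof (rule bigoI)
    show "eventually (\<lambda>n. norm (real (the_enat (tcl (grid n)))) \<le>
        (3 * 24 * 10 * 4000 * 9 * 4000 * 16) * norm (real n ^ 4 * ln (real n) ^ 4)) at_top"
    proof (rule eventually_mono[OF eventually_ge_at_top[of 1000]])
      fix n :: nat assume "1000 \<le> n"
      then interpret large_grid n by unfold_locales
      show "norm (real (the_enat (tcl (grid n)))) \<le>
          (3 * 24 * 10 * 4000 * 9 * 4000 * 16) * norm (real n ^ 4 * ln (real n) ^ 4)"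
        using tcl_le_growth by simp
    qed
  qed
qed

end
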